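(* Let $1\le k\le n$ and let $\mathbb T_n^k$ be the simplicial complex on $[n]$ with facets $[n]\setminus\{i\}$, $i=1,\dots,k$. Then the toric ideal $I(\mathbb T_n^k)$ has degree $2^{(k-1)2^{(n-k)}}$.
   Context: For a simplicial complex $\Delta$ on $[n]=\{1,\dots,n\}$, $\mathrm{facets}(\Delta)$ is its set of inclusion-maximal faces. Let $\mathbb K$ be a field. The toric ideal $I(\Delta)$ of the binary hierarchical model of $\Delta$ is the kernel of the $\mathbb K$-algebra homomorphism $$f_\Delta:\mathbb K[p_S : S\subset[n]]\to\mathbb K[\theta_{(H,F)} : H\subset F\in\mathrm{facets}(\Delta)],\qquad p_S\mapsto\prod_{F\in\mathrm{facets}(\Delta)}\theta_{(S\cap F,F)}.$$ It is homogeneous for the standard grading on $R=\mathbb K[p_S : S\subset[n]]$. Writing the Hilbert series of $R/I(\Delta)$ as $\sum_{d\ge0}\dim_{\mathbb K}[R/I(\Delta)]_d\,t^d=k(t)/(1-t)^{\dim(R/I(\Delta))}$ with $k(t)\in\mathbb Z[t]$, $k(1)>0$, the degree of $I(\Delta)$ is $k(1)$. *)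

theory Defs
  imports
    "HOL-Library.Poly_Mapping"
    "HOL-Library.Extended_Nat"
    "HOL-Computational_Algebra.Polynomial_FPS"
    "HOL-Algebra.QuotRing"
    "HOL-Algebra.Embedded_Algebras"
begin

section \<open>Simplicial complexes\<close>

text \<open>Elements of the vertex set need not be faces: the vertex 1 is not a face of the complex
  on {1..n} whose only facet is {2..n}.\<close>

definition simplicial_complex :: "'a set \<Rightarrow> 'a set set \<Rightarrow> bool" where
  "simplicial_complex V \<Delta> \<longleftrightarrow>
     finite V \<and> {} \<in> \<Delta> \<and> \<Delta> \<subseteq> Pow V \<and> (\<forall>F\<in>\<Delta>. \<forall>G. G \<subseteq> F \<longrightarrow> G \<in> \<Delta>)"

definition facets :: "'a set set \<Rightarrow> 'a set set" where
  "facets \<Delta> = {F \<in> \<Delta>. \<forall>G\<in>\<Delta>. F \<subseteq> G \<longrightarrow> G = F}"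

section \<open>Polynomial rings over a field\<close>

text \<open>A monomial is a finitely supported exponent vector and a polynomial a finitely supported
  family of coefficients indexed by monomials. The type has one variable for each element of
  \<open>'v\<close>; \<open>poly_ring X\<close> is the subring of polynomials whose variables lie in \<open>X\<close>.\<close>

type_synonym ('v, 'k) mpoly = "('v \<Rightarrow>\<^sub>0 nat) \<Rightarrow>\<^sub>0 'k"

definition Const :: "'k \<Rightarrow> ('v, 'k::zero) mpoly" where
  "Const c = Poly_Mapping.single 0 c"

definition Var :: "'v \<Rightarrow> ('v, 'k::zero_neq_one) mpoly" where
  "Var v = Poly_Mapping.single (Poly_Mapping.single v 1) 1"

definition poly_ring :: "'v set \<Rightarrow> ('v, 'k::field) mpoly ring" where
  "poly_ring X =
     \<lparr>carrier = {q. \<forall>m\<in>Poly_Mapping.keys q. Poly_Mapping.keys m \<subseteq> X},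
      mult = (*), one = 1, zero = 0, add = (+)\<rparr>"

text \<open>The algebra homomorphism given by \<open>v \<mapsto> g v\<close> on the variables.\<close>

definition subst_hom :: "('v \<Rightarrow> ('w, 'k) mpoly) \<Rightarrow> ('v, 'k::field) mpoly \<Rightarrow> ('w, 'k) mpoly" where
  "subst_hom g q =
     (\<Sum>m\<in>Poly_Mapping.keys q.
        Const (Poly_Mapping.lookup q m) *
        (\<Prod>v\<in>Poly_Mapping.keys m. g v ^ Poly_Mapping.lookup m v))"

definition monom_deg :: "('v \<Rightarrow>\<^sub>0 nat) \<Rightarrow> nat" where
  "monom_deg m = (\<Sum>v\<in>Poly_Mapping.keys m. Poly_Mapping.lookup m v)"

definition homog_part :: "'v set \<Rightarrow> nat \<Rightarrow> ('v, 'k::field) mpoly set" where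
  "homog_part X d = {q \<in> carrier (poly_ring X). \<forall>m\<in>Poly_Mapping.keys q. monom_deg m = d}"

section \<open>Hilbert series and degree of a homogeneous ideal\<close>

text \<open>The degree \<open>d\<close> component of \<open>R/I\<close>, where \<open>R = poly_ring X\<close>, is the image of the degree
  \<open>d\<close> component of \<open>R\<close>. Its dimension is taken over the image of the constants, which is a copy
  of the coefficient field whenever \<open>I\<close> is a proper ideal.\<close>

definition hilbert_fun :: "'v set \<Rightarrow> ('v, 'k::field) mpoly set \<Rightarrow> nat \<Rightarrow> nat" where
  "hilbert_fun X I d =
     ring.dim (poly_ring X Quot I)
       ((\<lambda>c. I +>\<^bsub>poly_ring X\<^esub> Const c) ` UNIV)
       ((\<lambda>q. I +>\<^bsub>poly_ring X\<^esub> q) ` homog_part X d)"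

definition hilbert_series :: "'v set \<Rightarrow> ('v, 'k::field) mpoly set \<Rightarrow> int fps" where
  "hilbert_series X I = Abs_fps (\<lambda>d. int (hilbert_fun X I d))"

definition krull_dim :: "('a, 'b) ring_scheme \<Rightarrow> enat" where
  "krull_dim R =
     Sup {enat m | m. \<exists>P. (\<forall>i\<le>m. primeideal (P i) R) \<and> (\<forall>i<m. P i \<subset> P (Suc i))}"

text \<open>The identity \<open>HS = k / (1 - t)^D\<close> is written with the denominator cleared. Both \<open>D\<close> and
  \<open>k\<close> are determined by \<open>I\<close>, so at most one \<open>e\<close> satisfies the predicate; stating it as a relation
  makes the existence of \<open>D\<close> and \<open>k\<close> part of the assertion.\<close>

definition has_degree :: "'v set \<Rightarrow> ('v, 'k::field) mpoly set \<Rightarrow> int \<Rightarrow> bool" where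
  "has_degree X I e \<longleftrightarrow>
     (\<exists>D (k :: int poly).
        krull_dim (poly_ring X Quot I) = enat D \<and>
        hilbert_series X I * (1 - fps_X) ^ D = fps_of_poly k \<and>
        poly k 1 > 0 \<and> e = poly k 1)"

section \<open>The toric ideal of the binary hierarchical model\<close>

definition hier_map ::
    "nat set set \<Rightarrow> (nat set, 'k::field) mpoly \<Rightarrow> (nat set \<times> nat set, 'k) mpoly" where
  "hier_map \<Delta> = subst_hom (\<lambda>S. \<Prod>F\<in>facets \<Delta>. Var (S \<inter> F, F))"

definition toric_ideal :: "nat \<Rightarrow> nat set set \<Rightarrow> (nat set, 'k::field) mpoly set" where
  "toric_ideal n \<Delta> =
     a_kernel (poly_ring (Pow {1..n})) (poly_ring {(H, F). H \<subseteq> F \<and> F \<in> facets \<Delta>}) (hier_map \<Delta>)"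

end

theory Submission
  imports Defs "HOL-Library.Nat_Bijection"
begin

text \<open>
  Split the variables \<open>p\<^sub>S\<close> into blocks according to \<open>B = S \<inter> {k+1..n}\<close>, and call a variable even or
  odd according to the parity of the number of elements of \<open>S \<inter> {1..k}\<close>. There are \<open>b = 2^(n-k)\<close>
  blocks, and each has \<open>e = 2^(k-1)\<close> even and \<open>e\<close> odd variables. The facet that misses \<open>i\<close> records
  the sums of the exponents at \<open>S\<close> and \<open>S \<union> {i}\<close>, so two monomials have the same image if and only if
  the difference of their exponents is, on each block, a constant \<open>c\<close> on the even and \<open>-c\<close> on the odd
  variables (lemma \<open>margins_eq_iff_alternating\<close>). The toric ideal thus identifies, in each block, the
  product of the even variables with the product of the odd ones. These are \<open>b\<close> binomials of degree
  \<open>e\<close> in disjoint sets of variables, like a complete intersection of degree \<open>e^b\<close>.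

  The degree is computed from a monomial basis of the quotient. Every monomial is congruent to exactly
  one monomial of the same degree that is divisible by none of the products of even variables
  (\<open>exists_normal_form\<close>, \<open>normal_form_unique\<close>), and each of these \<open>b\<close> conditions multiplies the
  generating function of the monomials by \<open>1 - t^e\<close> (\<open>normal_forms_series\<close>). Hence the Hilbert
  series is \<open>(1 - t^e)^b / (1 - t)^(2 e b) = (1 + t + ... + t^(e-1))^b / (1 - t)^D\<close> with
  \<open>D = (2 e - 1) b\<close>, and the numerator takes the value \<open>e^b\<close> at 1.

  It remains to see that \<open>D\<close> is the Krull dimension. For the upper bound let
  \<open>Q\<^sub>0 \<subset> \<dots> \<subset> Q\<^sub>m\<close> be primes above the toric ideal and choose \<open>f\<^sub>i\<close> in \<open>Q\<^sub>i\<^sub>+\<^sub>1\<close> but not in \<open>Q\<^sub>i\<close>. The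
  products of powers of the \<open>f\<^sub>i\<close> are linearly independent modulo \<open>Q\<^sub>0\<close>
  (\<open>prime_chain_monomials_independent\<close>), so the quotient grows at least like \<open>t^m\<close>. But the number of
  normal forms of degree at most \<open>t\<close> is at most \<open>e^b (t + 1)^D\<close>, since each of them omits a
  variable of each block (\<open>normal_forms_growth\<close>); so \<open>m \<le> D\<close>. For the lower bound, follow the
  parametrisation by setting the variables of a set \<open>Z\<close> to 0. If \<open>Z\<close> meets each block either not at all
  or in both an even and an odd variable, the kernel is a prime above the toric ideal, and such sets
  form a chain of length \<open>D\<close> (\<open>chain_to_blocks\<close>).
\<close>

section \<open>Polynomial rings\<close>

lemma poly_ring_simps [simp]:
  "(\<otimes>\<^bsub>poly_ring X\<^esub>) = (*)" "\<one>\<^bsub>poly_ring X\<^esub> = 1"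
  "\<zero>\<^bsub>poly_ring X\<^esub> = 0" "(\<oplus>\<^bsub>poly_ring X\<^esub>) = (+)"
  by (simp_all add: poly_ring_def)

lemma poly_ring_carrier:
  "q \<in> carrier (poly_ring X) \<longleftrightarrow> (\<forall>m\<in>Poly_Mapping.keys q. Poly_Mapping.keys m \<subseteq> X)"
  by (simp add: poly_ring_def)

lemma keys_plus_nat:
  fixes u v :: "'v \<Rightarrow>\<^sub>0 nat"
  shows "Poly_Mapping.keys (u + v) = Poly_Mapping.keys u \<union> Poly_Mapping.keys v"
  by (auto simp: in_keys_iff lookup_add)

lemma monom_deg_superset:
  "finite S \<Longrightarrow> Poly_Mapping.keys u \<subseteq> S \<Longrightarrow> monom_deg u = (\<Sum>v\<in>S. Poly_Mapping.lookup u v)"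
  unfolding monom_deg_def
  by (rule sum.mono_neutral_left) (auto simp: in_keys_iff)

lemma monom_deg_plus: "monom_deg (u + v) = monom_deg u + monom_deg v"
proof -
  have *: "finite (Poly_Mapping.keys u \<union> Poly_Mapping.keys v)" by simp
  show ?thesis
    using monom_deg_superset[OF *, of u] monom_deg_superset[OF *, of v]
      monom_deg_superset[OF *, of "u + v"]
    by (simp add: keys_plus_nat lookup_add sum.distrib)
qed

lemma monom_deg_zero [simp]: "monom_deg 0 = 0"
  by (simp add: monom_deg_def)

lemma poly_ring_add_closed:
  fixes p q :: "('v, 'k::field) mpoly"
  assumes "p \<in> carrier (poly_ring X)" "q \<in> carrier (poly_ring X)"
  shows "p + q \<in> carrier (poly_ring X)"
  using assms keys_add[of p q] by (auto simp: poly_ring_carrier)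

lemma poly_ring_mult_closed:
  fixes p q :: "('v, 'k::field) mpoly"
  assumes "p \<in> carrier (poly_ring X)" "q \<in> carrier (poly_ring X)"
  shows "p * q \<in> carrier (poly_ring X)"
  using assms keys_mult[of p q] by (fastforce simp: poly_ring_carrier keys_plus_nat)

lemma poly_ring_uminus_closed:
  fixes p :: "('v, 'k::field) mpoly"
  assumes "p \<in> carrier (poly_ring X)"
  shows "- p \<in> carrier (poly_ring X)"
  using assms by (auto simp: poly_ring_carrier in_keys_iff)

lemma poly_ring_single_closed:
  "Poly_Mapping.keys m \<subseteq> X \<Longrightarrow> Poly_Mapping.single m c \<in> carrier (poly_ring X)"
  by (auto simp: poly_ring_carrier)

lemma poly_ring_Const_closed: "Const c \<in> carrier (poly_ring X)"
  unfolding Const_def by (rule poly_ring_single_closed) simp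

lemma poly_ring_one_closed: "(1 :: ('v, 'k::field) mpoly) \<in> carrier (poly_ring X)"
  by (auto simp: poly_ring_carrier)

lemma poly_ring_zero_closed: "(0 :: ('v, 'k::field) mpoly) \<in> carrier (poly_ring X)"
  by (auto simp: poly_ring_carrier)

lemma poly_ring_sum_closed:
  fixes f :: "'i \<Rightarrow> ('v, 'k::field) mpoly"
  shows "(\<And>i. i \<in> S \<Longrightarrow> f i \<in> carrier (poly_ring X)) \<Longrightarrow> sum f S \<in> carrier (poly_ring X)"
  by (induction S rule: infinite_finite_induct)
    (auto simp: poly_ring_zero_closed intro: poly_ring_add_closed)

lemma poly_ring_power_closed:
  fixes p :: "('v, 'k::field) mpoly"
  shows "p \<in> carrier (poly_ring X) \<Longrightarrow> p ^ a \<in> carrier (poly_ring X)"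
  by (induction a) (auto simp: poly_ring_one_closed intro: poly_ring_mult_closed)

lemma poly_ring_prod_closed:
  fixes f :: "'i \<Rightarrow> ('v, 'k::field) mpoly"
  shows "(\<And>i. i \<in> S \<Longrightarrow> f i \<in> carrier (poly_ring X)) \<Longrightarrow> prod f S \<in> carrier (poly_ring X)"
  by (induction S rule: infinite_finite_induct)
    (auto simp: poly_ring_one_closed intro: poly_ring_mult_closed)

lemma cring_poly_ring: "cring (poly_ring X :: ('v, 'k::field) mpoly ring)"
proof (rule cringI)
  show "abelian_group (poly_ring X :: ('v, 'k) mpoly ring)"
  proof (rule abelian_groupI; simp)
    show "\<exists>y\<in>carrier (poly_ring X). y + x = 0" if "x \<in> carrier (poly_ring X)"
      for x :: "('v, 'k) mpoly"
      by (rule bexI[of _ "- x"]) (auto simp: that poly_ring_uminus_closed)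
  qed (auto simp: algebra_simps poly_ring_zero_closed intro: poly_ring_add_closed)
  show "comm_monoid (poly_ring X :: ('v, 'k) mpoly ring)"
    by (rule comm_monoidI)
      (auto simp: algebra_simps poly_ring_one_closed intro: poly_ring_mult_closed)
qed (simp add: algebra_simps)

lemma poly_ring_a_inv:
  fixes x :: "('v, 'k::field) mpoly"
  assumes "x \<in> carrier (poly_ring X)"
  shows "\<ominus>\<^bsub>poly_ring X\<^esub> x = - x"
proof -
  interpret cring "poly_ring X :: ('v, 'k) mpoly ring" by (rule cring_poly_ring)
  show ?thesis
    by (rule minus_equality) (use assms in \<open>auto simp: poly_ring_uminus_closed\<close>)
qed

lemma poly_ring_a_minus:
  fixes x y :: "('v, 'k::field) mpoly"
  assumes "x \<in> carrier (poly_ring X)" "y \<in> carrier (poly_ring X)"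
  shows "x \<ominus>\<^bsub>poly_ring X\<^esub> y = x - y"
  using assms by (simp add: a_minus_def poly_ring_a_inv)

lemma poly_ring_ideal_diff:
  fixes I :: "('v, 'k::field) mpoly set"
  assumes "ideal I (poly_ring X)" "a \<in> I" "b \<in> I"
  shows "a - b \<in> I"
proof -
  interpret ideal I "poly_ring X" by fact
  have "a \<oplus>\<^bsub>poly_ring X\<^esub> (\<ominus>\<^bsub>poly_ring X\<^esub> b) \<in> I"
    using assms by (intro additive_subgroup.a_closed[OF additive_subgroup_axioms] additive_subgroup.a_inv_closed[OF additive_subgroup_axioms])
  thus ?thesis using assms by (simp add: poly_ring_a_inv)
qed

lemma poly_ring_coset_eq_iff:
  fixes I :: "('v, 'k::field) mpoly set"
  assumes "ideal I (poly_ring X)" "a \<in> carrier (poly_ring X)" "b \<in> carrier (poly_ring X)"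
  shows "I +>\<^bsub>poly_ring X\<^esub> a = I +>\<^bsub>poly_ring X\<^esub> b \<longleftrightarrow> a - b \<in> I"
proof -
  interpret ideal I "poly_ring X" by fact
  have "a - b \<in> I \<longleftrightarrow> a \<in> I +>\<^bsub>poly_ring X\<^esub> b"
    using a_rcos_module_minus[OF ring_axioms assms(3,2)] assms by (simp add: poly_ring_a_minus)
  also have "\<dots> \<longleftrightarrow> I +>\<^bsub>poly_ring X\<^esub> a = I +>\<^bsub>poly_ring X\<^esub> b"
    using a_repr_independence'[OF _ assms(3), of a] a_rcos_self[OF assms(2)] by blast
  finally show ?thesis by simp
qed

section \<open>Monomial homomorphisms\<close>

text \<open>The linear map that sends a monomial \<open>m\<close> to the monomial \<open>A m\<close> if \<open>N m\<close> holds and to 0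
  otherwise. With \<open>N\<close> constantly true it describes a toric parametrisation on exponents; smaller
  \<open>N\<close> describe the parametrisation followed by setting some variables to 0.\<close>

definition monomial_map ::
    "('a \<Rightarrow> 'b) \<Rightarrow> ('a \<Rightarrow> bool) \<Rightarrow> ('a \<Rightarrow>\<^sub>0 'k::comm_ring_1) \<Rightarrow> ('b \<Rightarrow>\<^sub>0 'k)" where
  "monomial_map A N q =
     (\<Sum>m\<in>Poly_Mapping.keys q.
        if N m then Poly_Mapping.single (A m) (Poly_Mapping.lookup q m) else 0)"

lemma monomial_map_superset:
  assumes "finite S" "Poly_Mapping.keys q \<subseteq> S"
  shows "monomial_map A N q =
    (\<Sum>m\<in>S. if N m then Poly_Mapping.single (A m) (Poly_Mapping.lookup q m) else 0)"
  unfolding monomial_map_def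
  by (rule sum.mono_neutral_left) (use assms in \<open>auto simp: in_keys_iff\<close>)

lemma monomial_map_zero [simp]: "monomial_map A N 0 = 0"
  by (simp add: monomial_map_def)

lemma monomial_map_single:
  "monomial_map A N (Poly_Mapping.single m c) = (if N m then Poly_Mapping.single (A m) c else 0)"
  by (cases "c = 0") (simp_all add: monomial_map_def)

lemma monomial_map_add: "monomial_map A N (p + q) = monomial_map A N p + monomial_map A N q"
proof -
  let ?S = "Poly_Mapping.keys p \<union> Poly_Mapping.keys q"
  have "monomial_map A N r =
      (\<Sum>m\<in>?S. if N m then Poly_Mapping.single (A m) (Poly_Mapping.lookup r m) else 0)"
    if "Poly_Mapping.keys r \<subseteq> ?S" for r
    by (rule monomial_map_superset) (use that in auto)
  note * = this[OF Un_upper1] this[OF Un_upper2] this[OF keys_add]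
  show ?thesis
    unfolding * sum.distrib[symmetric]
    by (intro sum.cong refl) (simp add: lookup_add single_add)
qed

lemma monomial_map_sum: "monomial_map A N (\<Sum>i\<in>S. f i) = (\<Sum>i\<in>S. monomial_map A N (f i))"
  by (induction S rule: infinite_finite_induct) (auto simp: monomial_map_add)

lemma monomial_map_diff: "monomial_map A N (p - q) = monomial_map A N p - monomial_map A N q"
  using monomial_map_add[of A N "p - q" q] by (simp add: eq_diff_eq)

lemma poly_mapping_sum_single:
  "q = (\<Sum>m\<in>Poly_Mapping.keys q. Poly_Mapping.single m (Poly_Mapping.lookup q m))"
proof (rule poly_mapping_eqI)
  fix m
  show "Poly_Mapping.lookup q m = Poly_Mapping.lookup
    (\<Sum>m\<in>Poly_Mapping.keys q. Poly_Mapping.single m (Poly_Mapping.lookup q m)) m"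
    by (cases "m \<in> Poly_Mapping.keys q")
      (auto simp: lookup_sum lookup_single when_def in_keys_iff sum.delta)
qed

text \<open>By the hypothesis on \<open>N\<close> the killed monomials form a prime ideal of the exponent monoid, so a
  product of two monomials is killed precisely if one of the factors is.\<close>

lemma monomial_map_mult:
  fixes A :: "'a::comm_monoid_add \<Rightarrow> 'b::comm_monoid_add"
  assumes A: "\<And>u v. A (u + v) = A u + A v" and N: "\<And>u v. N (u + v) \<longleftrightarrow> N u \<and> N v"
  shows "monomial_map A N (p * q) = monomial_map A N p * monomial_map A N q"
proof -
  let ?s = Poly_Mapping.single and ?l = Poly_Mapping.lookup and ?k = Poly_Mapping.keys
  have "p * q = (\<Sum>m\<in>?k p. ?s m (?l p m)) * (\<Sum>m\<in>?k q. ?s m (?l q m))"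
    by (intro arg_cong2[where f = "(*)"] poly_mapping_sum_single)
  also have "\<dots> = (\<Sum>m\<in>?k p. \<Sum>m'\<in>?k q. ?s (m + m') (?l p m * ?l q m'))"
    by (simp add: sum_product mult_single)
  finally have "monomial_map A N (p * q) =
      (\<Sum>m\<in>?k p. \<Sum>m'\<in>?k q. monomial_map A N (?s (m + m') (?l p m * ?l q m')))"
    by (simp add: monomial_map_sum)
  also have "\<dots> = monomial_map A N p * monomial_map A N q"
    unfolding monomial_map_def[of A N p] monomial_map_def[of A N q] sum_product
    by (intro sum.cong refl) (auto simp: monomial_map_single A N mult_single)
  finally show ?thesis .
qed

lemma lookup_monomial_map:
  "Poly_Mapping.lookup (monomial_map A N q) w =
     (\<Sum>m | m \<in> Poly_Mapping.keys q \<and> N m \<and> A m = w. Poly_Mapping.lookup q m)"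
proof -
  have "Poly_Mapping.lookup (monomial_map A N q) w =
      (\<Sum>m\<in>Poly_Mapping.keys q. if N m \<and> A m = w then Poly_Mapping.lookup q m else 0)"
    unfolding monomial_map_def lookup_sum
    by (intro sum.cong refl) (auto simp: lookup_single when_def)
  also have "\<dots> = (\<Sum>m | m \<in> Poly_Mapping.keys q \<and> N m \<and> A m = w. Poly_Mapping.lookup q m)"
    by (rule sum.inter_filter[symmetric]) simp
  finally show ?thesis .
qed

text \<open>A polynomial lies in the kernel if and only if its coefficients sum to 0 over every surviving fibre of the
  exponent map. So only the fibres matter, and killing further whole fibres enlarges the kernel.\<close>

lemma monomial_map_eq_0_transfer:
  assumes zero: "monomial_map A N q = 0"
    and fibres: "\<And>u v. u \<in> Poly_Mapping.keys q \<Longrightarrow> v \<in> Poly_Mapping.keys q \<Longrightarrow> N' u \<Longrightarrow>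
      A' u = A' v \<and> N' v \<longleftrightarrow> A u = A v \<and> N v"
  shows "monomial_map A' N' q = 0"
proof (rule poly_mapping_eqI)
  fix w
  let ?F = "\<lambda>A N w. {m. m \<in> Poly_Mapping.keys q \<and> N m \<and> A m = w}"
  show "Poly_Mapping.lookup (monomial_map A' N' q) w = Poly_Mapping.lookup 0 w"
  proof (cases "?F A' N' w = {}")
    case True
    thus ?thesis unfolding lookup_monomial_map by (simp only: True) simp
  next
    case False
    then obtain u where u: "u \<in> Poly_Mapping.keys q" "N' u" "A' u = w" by auto
    have "N' v \<and> A' v = w \<longleftrightarrow> N v \<and> A v = A u" if "v \<in> Poly_Mapping.keys q" for v
      using fibres[OF u(1) that u(2)] u(3) by metis
    hence "?F A' N' w = ?F A N (A u)"
      by blast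
    hence "Poly_Mapping.lookup (monomial_map A' N' q) w
        = Poly_Mapping.lookup (monomial_map A N q) (A u)"
      unfolding lookup_monomial_map by simp
    thus ?thesis by (simp add: zero)
  qed
qed

definition toric_kernel ::
    "'v set \<Rightarrow> (('v \<Rightarrow>\<^sub>0 nat) \<Rightarrow> 'm) \<Rightarrow> (('v \<Rightarrow>\<^sub>0 nat) \<Rightarrow> bool) \<Rightarrow> ('v, 'k::field) mpoly set" where
  "toric_kernel X A N = {q \<in> carrier (poly_ring X). monomial_map A N q = 0}"

lemma toric_kernel_subset: "toric_kernel X A N \<subseteq> carrier (poly_ring X)"
  by (auto simp: toric_kernel_def)

lemma ideal_toric_kernel:
  fixes A :: "('v \<Rightarrow>\<^sub>0 nat) \<Rightarrow> 'm::comm_monoid_add"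
  assumes A: "\<And>u v. A (u + v) = A u + A v" and N: "\<And>u v. N (u + v) \<longleftrightarrow> N u \<and> N v"
  shows "ideal (toric_kernel X A N :: ('v, 'k::field) mpoly set) (poly_ring X)"
proof -
  interpret R: cring "poly_ring X :: ('v, 'k) mpoly ring" by (rule cring_poly_ring)
  let ?K = "toric_kernel X A N :: ('v, 'k) mpoly set"
  have uminus: "- a \<in> ?K" if "a \<in> ?K" for a
    using that monomial_map_diff[of A N 0 a]
    by (auto simp: toric_kernel_def poly_ring_uminus_closed)
  show ?thesis
  proof (rule idealI)
    show "ring (poly_ring X :: ('v, 'k) mpoly ring)" by (rule R.ring_axioms)
    show "subgroup ?K (add_monoid (poly_ring X))"
    proof (rule R.add.subgroupI)
      show "?K \<noteq> {}" by (auto simp: toric_kernel_def poly_ring_zero_closed intro!: exI[of _ 0])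
      show "\<ominus>\<^bsub>poly_ring X\<^esub> a \<in> ?K" if "a \<in> ?K" for a
        using that toric_kernel_subset uminus poly_ring_a_inv by (metis subsetD)
    qed (auto simp: toric_kernel_def monomial_map_add intro: poly_ring_add_closed)
  qed (auto simp: toric_kernel_def monomial_map_mult[OF A N] intro: poly_ring_mult_closed)
qed

lemma one_notin_toric_kernel:
  assumes "N 0"
  shows "(1 :: ('v, 'k::field) mpoly) \<notin> toric_kernel X A N"
proof -
  have "Poly_Mapping.lookup (Poly_Mapping.single (A 0) (1::'k)) (A 0) \<noteq> 0" by simp
  hence "Poly_Mapping.single (A 0) (1::'k) \<noteq> 0" by (metis lookup_zero)
  thus ?thesis
    using assms monomial_map_single[of A N 0 "1::'k"] by (simp add: toric_kernel_def)
qed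

text \<open>The target is a monoid algebra over a linearly ordered cancellative monoid, hence a domain.\<close>

lemma primeideal_toric_kernel:
  fixes A :: "('v \<Rightarrow>\<^sub>0 nat) \<Rightarrow> 'm::{ordered_cancel_comm_monoid_add, linorder}"
  assumes A: "\<And>u v. A (u + v) = A u + A v" and N: "\<And>u v. N (u + v) \<longleftrightarrow> N u \<and> N v"
    and N0: "N 0"
  shows "primeideal (toric_kernel X A N :: ('v, 'k::field) mpoly set) (poly_ring X)"
proof (rule primeidealI)
  show "ideal (toric_kernel X A N :: ('v, 'k) mpoly set) (poly_ring X)"
    by (rule ideal_toric_kernel[OF A N])
  show "carrier (poly_ring X) \<noteq> (toric_kernel X A N :: ('v, 'k) mpoly set)"
    using one_notin_toric_kernel[of N X A, OF N0] poly_ring_one_closed by blast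
qed (auto simp: cring_poly_ring toric_kernel_def monomial_map_mult[OF A N])

section \<open>Hilbert functions of toric rings\<close>

text \<open>Dimensions over the image of \<open>Const\<close> are well defined only once that image is known to be a
  subfield.\<close>

lemma subfield_Const: "subfield (range Const) (poly_ring X :: ('v, 'k::field) mpoly ring)"
proof -
  interpret R: cring "poly_ring X :: ('v, 'k) mpoly ring" by (rule cring_poly_ring)
  have Const_simps: "Const a * Const b = (Const (a * b) :: ('v, 'k) mpoly)"
    "Const a + Const b = (Const (a + b) :: ('v, 'k) mpoly)"
    "- Const a = (Const (- a) :: ('v, 'k) mpoly)" for a b :: 'k
    by (simp_all add: Const_def mult_single single_add single_uminus)
  have Const_one: "(1 :: ('v, 'k) mpoly) = Const 1" and Const_zero: "(0 :: ('v, 'k) mpoly) = Const 0"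
    by (simp_all add: Const_def)
  have inj: "Const a = (Const b :: ('v, 'k) mpoly) \<longleftrightarrow> a = b" for a b :: 'k
    unfolding Const_def by (metis lookup_single_eq)
  have "subring (range Const) (poly_ring X :: ('v, 'k) mpoly ring)"
    by (rule R.subringI)
      (auto simp: poly_ring_a_inv poly_ring_Const_closed Const_simps Const_one)
  moreover have "Units (poly_ring X \<lparr>carrier := range Const\<rparr> :: ('v, 'k) mpoly ring) = range Const - {0}"
  proof (intro equalityI subsetI)
    fix x :: "('v, 'k) mpoly" assume "x \<in> range Const - {0}"
    then obtain a where a: "x = Const a" "a \<noteq> 0" using Const_zero by auto
    hence "x * Const (inverse a) = 1" by (simp add: Const_simps Const_one)
    thus "x \<in> Units (poly_ring X \<lparr>carrier := range Const\<rparr>)"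
      using a by (auto simp: Units_def mult.commute)
  qed (auto simp: Units_def)
  ultimately show ?thesis
    by (intro R.subfieldI R.subcringI') simp_all
qed

context
  fixes X :: "'v set" and I :: "('v, 'k::field) mpoly set"
  assumes I: "ideal I (poly_ring X)" and proper: "1 \<notin> I"
begin

interpretation R: cring "poly_ring X :: ('v, 'k) mpoly ring" by (rule cring_poly_ring)
interpretation I: ideal I "poly_ring X" by (rule I)
interpretation Q: ring "poly_ring X Quot I" by (rule I.quotient_is_ring)

abbreviation proj :: "('v, 'k) mpoly \<Rightarrow> ('v, 'k) mpoly set"
  where "proj q \<equiv> I +>\<^bsub>poly_ring X\<^esub> q"

lemma proj_hom:
  assumes "a \<in> carrier (poly_ring X)" "b \<in> carrier (poly_ring X)"
  shows "proj (a * b) = proj a \<otimes>\<^bsub>poly_ring X Quot I\<^esub> proj b"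
    and "proj (a + b) = proj a \<oplus>\<^bsub>poly_ring X Quot I\<^esub> proj b"
  using ring_hom_mult[OF I.rcos_ring_hom assms] ring_hom_add[OF I.rcos_ring_hom assms] by simp_all

lemma proj_closed: "a \<in> carrier (poly_ring X) \<Longrightarrow> proj a \<in> carrier (poly_ring X Quot I)"
  by (rule ring_hom_closed[OF I.rcos_ring_hom])

lemma subfield_quotient_scalars: "subfield ((\<lambda>c. proj (Const c)) ` UNIV) (poly_ring X Quot I)"
proof -
  have "proj 1 \<noteq> proj 0"
    using proper by (subst poly_ring_coset_eq_iff[OF I])
      (auto simp: poly_ring_one_closed poly_ring_zero_closed)
  hence "\<one>\<^bsub>poly_ring X Quot I\<^esub> \<noteq> \<zero>\<^bsub>poly_ring X Quot I\<^esub>"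
    using ring_hom_one[OF I.rcos_ring_hom] ring_hom_zero[OF I.rcos_ring_hom R.ring_axioms Q.ring_axioms]
    by simp
  thus ?thesis
    using ring_hom_ring.img_is_subfield(2)[OF I.rcos_ring_hom_ring subfield_Const]
    by (simp add: image_image)
qed

text \<open>The dimension predicate adds one vector at a time, so the induction on the family \<open>g\<close> follows
  its introduction rules.\<close>

lemma dimension_quotient_span:
  assumes "finite J" and "\<And>j. j \<in> J \<Longrightarrow> g j \<in> carrier (poly_ring X)"
    and "\<And>c j. (\<Sum>j\<in>J. Const (c j) * g j) \<in> I \<Longrightarrow> j \<in> J \<Longrightarrow> c j = 0"
  shows "Q.dimension (card J) ((\<lambda>c. proj (Const c)) ` UNIV)
           (range (\<lambda>c. proj (\<Sum>j\<in>J. Const (c j) * g j)))"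
  using assms
proof (induction J rule: finite_induct)
  case empty
  have "proj 0 = \<zero>\<^bsub>poly_ring X Quot I\<^esub>"
    using ring_hom_zero[OF I.rcos_ring_hom R.ring_axioms Q.ring_axioms] by simp
  thus ?case by (simp add: Q.zero_dim)
next
  case (insert i J)
  let ?K = "(\<lambda>c. proj (Const c)) ` UNIV"
  let ?s = "\<lambda>J c. \<Sum>j\<in>J. Const (c j) * g j"
  let ?E = "range (\<lambda>c. proj (?s J c))"
  have g: "g j \<in> carrier (poly_ring X)" if "j \<in> insert i J" for j
    using insert.prems(1) that by simp
  have closed: "?s J c \<in> carrier (poly_ring X)" for c
    by (intro poly_ring_sum_closed poly_ring_mult_closed poly_ring_Const_closed g) auto
  have upd: "?s (insert i J) (c(i := a)) = Const a * g i + ?s J c" for c a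
    using insert.hyps by (auto intro!: sum.cong)
  have indep: "a = 0 \<and> (\<forall>j\<in>J. c j = 0)" if "Const a * g i + ?s J c \<in> I" for a c
  proof -
    have zero: "(c(i := a)) j = 0" if "j \<in> insert i J" for j
      by (rule insert.prems(2)) (use \<open>Const a * g i + ?s J c \<in> I\<close> upd that in simp_all)
    show ?thesis
    proof (intro conjI ballI)
      show "a = 0" using zero[of i] by simp
      show "c j = 0" if "j \<in> J" for j
        using zero[of j] that insert.hyps by (auto split: if_splits)
    qed
  qed
  have "Q.dimension (card J) ?K ?E"
  proof (rule insert.IH)
    show "c j = 0" if "?s J c \<in> I" "j \<in> J" for c j
      using indep[of 0 c] that by (simp add: Const_def)
  qed (use g in auto)
  moreover have "proj (g i) \<notin> ?E"
  proof
    assume "proj (g i) \<in> ?E"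
    then obtain c where "proj (g i) = proj (?s J c)" by auto
    hence "g i - ?s J c \<in> I"
      using poly_ring_coset_eq_iff[OF I g closed] by simp
    moreover have "g i - ?s J c = Const 1 * g i + ?s J (\<lambda>j. - c j)"
      by (simp add: Const_def single_uminus sum_negf)
    ultimately show False using indep[of 1 "\<lambda>j. - c j"] by simp
  qed
  ultimately have "Q.dimension (Suc (card J)) ?K (Q.line_extension ?K (proj (g i)) ?E)"
    by (intro Q.Suc_dim proj_closed g) auto
  also have "Q.line_extension ?K (proj (g i)) ?E = range (\<lambda>c. proj (?s (insert i J) c))"
  proof -
    have *: "proj (Const a) \<otimes>\<^bsub>poly_ring X Quot I\<^esub> proj (g i) \<oplus>\<^bsub>poly_ring X Quot I\<^esub> proj (?s J c)
        = proj (?s (insert i J) (c(i := a)))" for a c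
      unfolding upd
      by (simp add: proj_hom closed g poly_ring_mult_closed poly_ring_Const_closed)
    have mem: "u \<in> Q.line_extension ?K (proj (g i)) ?E
        \<longleftrightarrow> (\<exists>a c. u = proj (?s (insert i J) (c(i := a))))" for u
      unfolding Q.line_extension_mem_iff by (auto simp: *)
    show ?thesis
    proof (intro equalityI subsetI)
      fix u assume "u \<in> Q.line_extension ?K (proj (g i)) ?E"
      thus "u \<in> range (\<lambda>c. proj (?s (insert i J) c))" unfolding mem by blast
    next
      fix u assume "u \<in> range (\<lambda>c. proj (?s (insert i J) c))"
      then obtain c where "u = proj (?s (insert i J) (c(i := c i)))" by auto
      thus "u \<in> Q.line_extension ?K (proj (g i)) ?E" unfolding mem by blast
    qed
  qed
  finally show ?case using insert.hyps by simp
qed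

end

text \<open>One monomial chosen in every fibre of the exponent map gives a basis of the degree \<open>d\<close>
  component of the toric ring: monomials with equal images are congruent, and monomials with
  different images stay linearly independent.\<close>

lemma hilbert_fun_toric_kernel:
  fixes A :: "('v \<Rightarrow>\<^sub>0 nat) \<Rightarrow> 'm::comm_monoid_add"
  assumes A: "\<And>u v. A (u + v) = A u + A v"
    and fin: "finite (A ` {u. Poly_Mapping.keys u \<subseteq> X \<and> monom_deg u = d})"
  shows "hilbert_fun X (toric_kernel X A (\<lambda>_. True) :: ('v, 'k::field) mpoly set) d
           = card (A ` {u. Poly_Mapping.keys u \<subseteq> X \<and> monom_deg u = d})"
proof -
  let ?I = "toric_kernel X A (\<lambda>_. True) :: ('v, 'k) mpoly set"
  let ?M = "{u. Poly_Mapping.keys u \<subseteq> X \<and> monom_deg u = d}"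
  let ?K = "(\<lambda>c. ?I +>\<^bsub>poly_ring X\<^esub> Const c) ` UNIV"
  have I: "ideal ?I (poly_ring X)" by (rule ideal_toric_kernel) (auto simp: A)
  have proper: "1 \<notin> ?I" by (rule one_notin_toric_kernel) simp
  interpret Q: ring "poly_ring X Quot ?I" by (rule ideal.quotient_is_ring[OF I])
  define rep where "rep = (\<lambda>w. SOME u. u \<in> ?M \<and> A u = w)"
  have rep: "rep w \<in> ?M \<and> A (rep w) = w" if "w \<in> A ` ?M" for w
    unfolding rep_def by (rule someI_ex) (use that in auto)
  define g where "g = (\<lambda>w. Poly_Mapping.single (rep w) (1::'k))"
  define s where "s = (\<lambda>c. \<Sum>w\<in>A ` ?M. Const (c w) * g w)"
  have scale_g: "Const a * g w = Poly_Mapping.single (rep w) a" for a w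
    by (simp add: g_def Const_def mult_single)
  have g: "g w \<in> carrier (poly_ring X)" if "w \<in> A ` ?M" for w
    unfolding g_def by (rule poly_ring_single_closed) (use rep[OF that] in auto)
  have s_closed: "s c \<in> carrier (poly_ring X)" for c
    unfolding s_def by (intro poly_ring_sum_closed poly_ring_mult_closed poly_ring_Const_closed g)
  have map_s: "Poly_Mapping.lookup (monomial_map A (\<lambda>_. True) (s c)) w
      = (if w \<in> A ` ?M then c w else 0)" for c w
  proof -
    have "monomial_map A (\<lambda>_. True) (s c) = (\<Sum>w\<in>A ` ?M. Poly_Mapping.single w (c w))"
      unfolding s_def monomial_map_sum scale_g
      by (intro sum.cong refl) (use rep in \<open>simp add: monomial_map_single\<close>)
    also have "Poly_Mapping.lookup \<dots> w = (\<Sum>v\<in>A ` ?M. if v = w then c v else 0)"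
      unfolding lookup_sum by (intro sum.cong refl) (simp add: lookup_single when_def)
    also have "\<dots> = (if w \<in> A ` ?M then c w else 0)"
      using fin by simp
    finally show ?thesis .
  qed
  have indep: "c w = 0" if "s c \<in> ?I" "w \<in> A ` ?M" for c w
    using map_s[of c w] that by (simp add: toric_kernel_def)
  have dim: "Q.dimension (card (A ` ?M)) ?K (range (\<lambda>c. ?I +>\<^bsub>poly_ring X\<^esub> s c))"
    unfolding s_def
    by (rule dimension_quotient_span[OF I proper fin]) (use g indep[unfolded s_def] in auto)
  have "(\<lambda>q. ?I +>\<^bsub>poly_ring X\<^esub> q) ` homog_part X d = range (\<lambda>c. ?I +>\<^bsub>poly_ring X\<^esub> s c)"
  proof (intro equalityI subsetI)
    fix u assume "u \<in> (\<lambda>q. ?I +>\<^bsub>poly_ring X\<^esub> q) ` homog_part X d"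
    then obtain q where q: "q \<in> homog_part X d" and u: "u = ?I +>\<^bsub>poly_ring X\<^esub> q" by auto
    have qc: "q \<in> carrier (poly_ring X)" and qd: "\<And>m. m \<in> Poly_Mapping.keys q \<Longrightarrow> m \<in> ?M"
      using q by (auto simp: homog_part_def poly_ring_carrier)
    define c where "c = Poly_Mapping.lookup (monomial_map A (\<lambda>_. True) q)"
    have "c w = 0" if "w \<notin> A ` ?M" for w
      unfolding c_def lookup_monomial_map
      by (rule sum.neutral) (use qd that in auto)
    hence "monomial_map A (\<lambda>_. True) (s c) = monomial_map A (\<lambda>_. True) q"
      by (intro poly_mapping_eqI) (auto simp: map_s c_def)
    hence "q - s c \<in> ?I"
      using poly_ring_add_closed[OF qc poly_ring_uminus_closed[OF s_closed]]
      by (simp add: toric_kernel_def monomial_map_diff)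
    hence "u = ?I +>\<^bsub>poly_ring X\<^esub> s c"
      unfolding u by (subst poly_ring_coset_eq_iff[OF I qc s_closed])
    thus "u \<in> range (\<lambda>c. ?I +>\<^bsub>poly_ring X\<^esub> s c)" by blast
  next
    fix u assume "u \<in> range (\<lambda>c. ?I +>\<^bsub>poly_ring X\<^esub> s c)"
    then obtain c where u: "u = ?I +>\<^bsub>poly_ring X\<^esub> s c" by auto
    have "monom_deg m = d" if "m \<in> Poly_Mapping.keys (s c)" for m
    proof -
      have "m \<in> (\<Union>w\<in>A ` ?M. Poly_Mapping.keys (Poly_Mapping.single (rep w) (c w)))"
        using that keys_sum[of "\<lambda>w. Poly_Mapping.single (rep w) (c w)" "A ` ?M"]
        unfolding s_def scale_g by blast
      thus ?thesis using rep by (auto split: if_splits)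
    qed
    thus "u \<in> (\<lambda>q. ?I +>\<^bsub>poly_ring X\<^esub> q) ` homog_part X d"
      using u s_closed by (auto simp: homog_part_def)
  qed
  thus ?thesis
    using Q.dimI[OF subfield_quotient_scalars[OF I proper] dim]
    by (simp add: hilbert_fun_def over_def)
qed

section \<open>Krull dimension of a quotient\<close>

text \<open>As \<open>J\<close> contains \<open>I\<close>, it is a union of cosets of \<open>I\<close>, so membership in the image of \<open>J\<close> can be
  tested on any representative.\<close>

lemma (in cring) primeideal_quotient_image:
  assumes I: "ideal I R" and J: "primeideal J R" and sub: "I \<subseteq> J"
  shows "primeideal ((+>) I ` J) (R Quot I)"
proof (rule primeidealI)
  interpret I: ideal I R by (rule I)
  interpret J: primeideal J R by (rule J)
  show "ideal ((+>) I ` J) (R Quot I)" by (rule ring_ideal_imp_quot_ideal[OF I J.ideal_axioms])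
  show "cring (R Quot I)" by (rule I.quotient_is_cring[OF cring_axioms])
  have mem: "a \<in> J" if a: "a \<in> carrier R" "I +> a \<in> (+>) I ` J" for a
  proof -
    obtain j where j: "j \<in> J" "I +> a = I +> j" using a by auto
    have "a \<in> I +> j" using I.a_rcos_self[OF a(1)] j(2) by simp
    then obtain h where "h \<in> I" "a = h \<oplus> j" by (auto simp: a_r_coset_def')
    thus ?thesis using j(1) sub by auto
  qed
  have carrier: "carrier (R Quot I) = (+>) I ` carrier R"
    by (auto simp: FactRing_def A_RCOSETS_def')
  show "carrier (R Quot I) \<noteq> (+>) I ` J"
  proof
    assume eq: "carrier (R Quot I) = (+>) I ` J"
    have "a \<in> J" if "a \<in> carrier R" for a
      by (rule mem[OF that]) (use that in \<open>simp add: eq[symmetric] carrier\<close>)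
    thus False using J.I_notcarr J.Icarr by blast
  qed
  show "x \<in> (+>) I ` J \<or> y \<in> (+>) I ` J"
    if xy: "x \<in> carrier (R Quot I)" "y \<in> carrier (R Quot I)" "x \<otimes>\<^bsub>R Quot I\<^esub> y \<in> (+>) I ` J" for x y
  proof -
    obtain a b where ab: "a \<in> carrier R" "b \<in> carrier R" "x = I +> a" "y = I +> b"
      using xy(1,2) unfolding carrier by blast
    have "I +> (a \<otimes> b) \<in> (+>) I ` J"
      using xy(3) ab ring_hom_mult[OF I.rcos_ring_hom ab(1,2)] by simp
    hence "a \<otimes> b \<in> J" by (rule mem[rotated]) (use ab in simp)
    thus ?thesis using J.I_prime ab by blast
  qed
qed

text \<open>Chains of primes of \<open>R/I\<close> correspond to chains of primes of \<open>R\<close> above \<open>I\<close>, so both bounds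
  can be checked in \<open>R\<close>.\<close>

lemma (in cring) krull_dim_quotient_eqI:
  assumes I: "ideal I R"
    and upper: "\<And>m P. (\<And>i. i \<le> m \<Longrightarrow> primeideal (P i) R) \<Longrightarrow> (\<And>i. i \<le> m \<Longrightarrow> I \<subseteq> P i) \<Longrightarrow>
      (\<And>i. i < m \<Longrightarrow> P i \<subset> P (Suc i)) \<Longrightarrow> m \<le> D"
    and prime: "\<And>i. i \<le> D \<Longrightarrow> primeideal (P i) R" and above: "\<And>i. i \<le> D \<Longrightarrow> I \<subseteq> P i"
    and strict: "\<And>i. i < D \<Longrightarrow> P i \<subset> P (Suc i)"
  shows "krull_dim (R Quot I) = enat D"
  unfolding krull_dim_def
proof (rule Sup_eqI)
  interpret I: ideal I R by (rule I)
  have inj: "inj_on (\<lambda>J. (+>) I ` J) {J. ideal J R \<and> I \<subseteq> J}"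
    using quot_ideal_correspondence[OF I] by (rule bij_betw_imp_inj_on)
  have strict': "(+>) I ` P i \<subset> (+>) I ` P (Suc i)" if "i < D" for i
  proof
    show "(+>) I ` P i \<subseteq> (+>) I ` P (Suc i)" using strict[OF that] by blast
    show "(+>) I ` P i \<noteq> (+>) I ` P (Suc i)"
      using inj_onD[OF inj, of "P i" "P (Suc i)"] prime[of i] prime[of "Suc i"] above[of i]
        above[of "Suc i"] strict[OF that] that by (auto dest: primeideal.axioms(1))
  qed
  have prime': "primeideal ((+>) I ` P i) (R Quot I)" if "i \<le> D" for i
    by (rule primeideal_quotient_image[OF I prime above]) (use that in auto)
  have "enat D \<in> {enat m | m. \<exists>P. (\<forall>i\<le>m. primeideal (P i) (R Quot I)) \<and>
      (\<forall>i<m. P i \<subset> P (Suc i))}"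
  proof (intro CollectI exI conjI refl allI impI)
    show "primeideal ((+>) I ` P i) (R Quot I)" if "i \<le> D" for i by (rule prime'[OF that])
    show "(+>) I ` P i \<subset> (+>) I ` P (Suc i)" if "i < D" for i by (rule strict'[OF that])
  qed (rule refl)
  thus "enat D \<le> y" if that: "\<And>z. z \<in> {enat m | m. \<exists>P. (\<forall>i\<le>m. primeideal (P i) (R Quot I)) \<and>
      (\<forall>i<m. P i \<subset> P (Suc i))} \<Longrightarrow> z \<le> y" for y
    by (rule that)
  fix z assume "z \<in> {enat m | m. \<exists>P. (\<forall>i\<le>m. primeideal (P i) (R Quot I)) \<and>
      (\<forall>i<m. P i \<subset> P (Suc i))}"
  then obtain m P' where z: "z = enat m" and P': "\<And>i. i \<le> m \<Longrightarrow> primeideal (P' i) (R Quot I)"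
    "\<And>i. i < m \<Longrightarrow> P' i \<subset> P' (Suc i)" by auto
  let ?V = "\<lambda>i. {r \<in> carrier R. I +> r \<in> P' i}"
  have "m \<le> D"
  proof (rule upper)
    show "primeideal (?V i) R" if "i \<le> m" for i
      by (rule ring_hom_ring.primeideal_vimage[OF I.rcos_ring_hom_ring cring_axioms P'(1)[OF that]])
    show "I \<subseteq> ?V i" if "i \<le> m" for i
    proof
      fix a assume a: "a \<in> I"
      interpret P: primeideal "P' i" "R Quot I" by (rule P'(1)[OF that])
      have "I +> a = \<zero>\<^bsub>R Quot I\<^esub>"
        using a_coset_join2[OF I.Icarr[OF a] I.a_subgroup a] by (simp add: FactRing_def)
      thus "a \<in> ?V i" using I.Icarr[OF a] P.zero_closed by simp
    qed
    show "?V i \<subset> ?V (Suc i)" if i: "i < m" for i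
    proof
      show "?V i \<subseteq> ?V (Suc i)" using P'(2)[OF i] by auto
      obtain x where x: "x \<in> P' (Suc i)" "x \<notin> P' i" using P'(2)[OF i] by auto
      have "ideal (P' (Suc i)) (R Quot I)"
        using P'(1)[of "Suc i"] i by (simp add: primeideal.axioms(1))
      hence "x \<in> carrier (R Quot I)" using x(1) by (rule ideal.Icarr)
      then obtain a where "a \<in> carrier R" "x = I +> a"
        by (auto simp: FactRing_def A_RCOSETS_def')
      thus "?V i \<noteq> ?V (Suc i)" using x by auto
    qed
  qed
  thus "z \<le> enat D" by (simp add: z)
qed

section \<open>Growth bounds the length of chains of primes\<close>

lemma prime_cancel_power:
  fixes P :: "('v, 'k::field) mpoly set"
  assumes P: "primeideal P (poly_ring X)" and "f \<in> carrier (poly_ring X)" "f \<notin> P"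
    and "r \<in> carrier (poly_ring X)" "f ^ a * r \<in> P"
  shows "r \<in> P"
  using assms(5)
proof (induction a)
  case (Suc a)
  have "f * (f ^ a * r) \<in> P" using Suc.prems by (simp add: mult.assoc)
  hence "f ^ a * r \<in> P"
    using primeideal.I_prime[OF P, of f "f ^ a * r"] assms(2-4)
    by (auto intro: poly_ring_mult_closed poly_ring_power_closed)
  thus ?case by (rule Suc.IH)
qed simp

text \<open>A strictly increasing chain of primes yields algebraically independent elements modulo its
  smallest member. In a relation modulo \<open>Q 0\<close>, group the terms by the power of \<open>f 0\<close>, and
  cancel the lowest power that occurs, which is possible since \<open>f 0\<close> is not in the prime \<open>Q 0\<close>. As
  \<open>f 0\<close> lies in \<open>Q 1\<close>, what is left of the lowest group is a relation modulo \<open>Q 1\<close> among the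
  remaining elements. Exponent vectors are lists, so that peeling off \<open>f 0\<close> is peeling off the
  head.\<close>

lemma prime_chain_monomials_independent:
  fixes Q :: "nat \<Rightarrow> ('v, 'k::field) mpoly set" and f :: "nat \<Rightarrow> ('v, 'k) mpoly"
  assumes "\<And>i. i \<le> m \<Longrightarrow> primeideal (Q i) (poly_ring X)"
    and "\<And>i. i < m \<Longrightarrow> Q i \<subseteq> Q (Suc i)"
    and "\<And>i. i < m \<Longrightarrow> f i \<in> Q (Suc i) - Q i"
    and "(\<Sum>as | set as \<subseteq> {..d} \<and> length as = m.
            Const (c as) * (\<Prod>i<m. f i ^ (as ! i))) \<in> Q 0"
    and "set as \<subseteq> {..d}" "length as = m"
  shows "c as = 0"
  using assms
proof (induction m arbitrary: Q f c as)
  case 0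
  interpret Q: primeideal "Q 0" "poly_ring X" using 0 by simp
  have "{as. set as \<subseteq> {..d} \<and> length as = 0} = {[]}" by auto
  hence mem: "Const (c []) \<in> Q 0" using 0(4) by simp
  show ?case
  proof (rule ccontr)
    assume "c as \<noteq> 0"
    hence "Const (inverse (c [])) * Const (c []) = (1 :: ('v, 'k) mpoly)"
      using 0 by (simp add: Const_def mult_single)
    hence "1 \<in> Q 0"
      using Q.I_l_closed[OF mem poly_ring_Const_closed[of "inverse (c [])"]] by simp
    thus False using Q.one_imp_carrier Q.I_notcarr by simp
  qed
next
  case (Suc m)
  let ?L = "\<lambda>m. {as. set as \<subseteq> {..d} \<and> length as = m}"
  have fin: "finite (?L m)" for m by (rule finite_lists_length_eq) simp
  have carr: "Q i \<subseteq> carrier (poly_ring X)" if "i \<le> Suc m" for i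
    using ideal.Icarr[OF primeideal.axioms(1)[OF Suc.prems(1)[OF that]]] by blast
  have f_closed: "f i \<in> carrier (poly_ring X)" if "i \<le> m" for i
    using Suc.prems(3)[of i] carr[of "Suc i"] that by auto
  define r where "r = (\<lambda>a. \<Sum>as\<in>?L m. Const (c (a # as)) * (\<Prod>i<m. f (Suc i) ^ (as ! i)))"
  have r_closed: "r a \<in> carrier (poly_ring X)" for a
    unfolding r_def
    by (intro poly_ring_sum_closed poly_ring_mult_closed poly_ring_Const_closed
        poly_ring_prod_closed poly_ring_power_closed f_closed) auto
  have "(\<Sum>as\<in>?L (Suc m). Const (c as) * (\<Prod>i<Suc m. f i ^ (as ! i)))
      = (\<Sum>(a, as)\<in>{..d} \<times> ?L m. Const (c (a # as)) * (\<Prod>i<Suc m. f i ^ ((a # as) ! i)))"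
    by (rule sum.reindex_bij_witness[of _ "\<lambda>(a, as). a # as" "\<lambda>as. (hd as, tl as)"])
      (auto simp: length_Suc_conv)
  also have "\<dots> = (\<Sum>a\<le>d. \<Sum>as\<in>?L m. f 0 ^ a * (Const (c (a # as)) * (\<Prod>i<m. f (Suc i) ^ (as ! i))))"
    by (simp add: sum.cartesian_product[symmetric] prod.lessThan_Suc_shift mult_ac
        del: prod.lessThan_Suc)
  also have "\<dots> = (\<Sum>a\<le>d. f 0 ^ a * r a)"
    by (simp add: r_def sum_distrib_left)
  finally have total: "(\<Sum>a\<le>d. f 0 ^ a * r a) \<in> Q 0" using Suc.prems(4) by simp
  interpret Q1: primeideal "Q 1" "poly_ring X" using Suc.prems(1)[of 1] by simp
  have f0: "f 0 \<in> Q 1" "f 0 \<notin> Q 0" using Suc.prems(3)[of 0] by auto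
  have zero: "\<forall>as\<in>?L m. c (a # as) = 0" if "a \<le> d" for a
    using that
  proof (induction a rule: less_induct)
    case (less a)
    let ?rest = "\<Sum>b\<in>{a<..d}. f 0 ^ (b - Suc a) * r b"
    have rest_closed: "?rest \<in> carrier (poly_ring X)"
      by (intro poly_ring_sum_closed poly_ring_mult_closed poly_ring_power_closed f_closed r_closed) simp
    have "r b = 0" if "b < a" for b
      unfolding r_def using less that by (intro sum.neutral) (simp add: Const_def)
    hence "(\<Sum>b\<le>d. f 0 ^ b * r b) = (\<Sum>b\<in>{a..d}. f 0 ^ b * r b)"
      by (intro sum.mono_neutral_right) auto
    also have "{a..d} = insert a {a<..d}" using less.prems by auto
    also have "(\<Sum>b\<in>insert a {a<..d}. f 0 ^ b * r b)
        = f 0 ^ a * r a + (\<Sum>b\<in>{a<..d}. f 0 ^ a * (f 0 * (f 0 ^ (b - Suc a) * r b)))"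
    proof -
      have "f 0 ^ b = f 0 ^ a * (f 0 * f 0 ^ (b - Suc a))" if "a < b" for b
      proof -
        have "b = a + Suc (b - Suc a)" using that by simp
        thus ?thesis by (metis power_add power_Suc)
      qed
      thus ?thesis by (auto simp: mult.assoc intro!: sum.cong)
    qed
    also have "\<dots> = f 0 ^ a * (r a + f 0 * ?rest)"
      by (simp add: distrib_left sum_distrib_left)
    finally have "f 0 ^ a * (r a + f 0 * ?rest) \<in> Q 0" using total by simp
    hence "r a + f 0 * ?rest \<in> Q 0"
      by (rule prime_cancel_power[rotated -1])
        (use Suc.prems(1)[of 0] f0 f_closed in \<open>auto intro!: poly_ring_add_closed
          poly_ring_mult_closed r_closed rest_closed\<close>)
    hence "r a + f 0 * ?rest \<in> Q 1" using Suc.prems(2)[of 0] by auto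
    moreover have "f 0 * ?rest \<in> Q 1" using Q1.I_r_closed[OF f0(1) rest_closed] by simp
    ultimately have "r a \<in> Q 1"
      using poly_ring_ideal_diff[OF Q1.ideal_axioms, of "r a + f 0 * ?rest" "f 0 * ?rest"] by simp
    hence *: "(\<Sum>as\<in>?L m. Const (c (a # as)) * (\<Prod>i<m. f (Suc i) ^ (as ! i))) \<in> Q (Suc 0)"
      by (simp add: r_def)
    show ?case
    proof
      fix as assume "as \<in> ?L m"
      thus "c (a # as) = 0"
        using Suc.IH[of "\<lambda>i. Q (Suc i)" "\<lambda>i. f (Suc i)" "\<lambda>as. c (a # as)" as]
          Suc.prems(1-3) * by simp
    qed
  qed
  obtain a as' where "as = a # as'" "a \<le> d" "as' \<in> ?L m"
    using Suc.prems(5,6) by (cases as) auto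
  thus ?case using zero by blast
qed

text \<open>The vectors \<open>b j\<close> lie in the span of the monomials indexed by \<open>W\<close>.\<close>

lemma card_le_keys_if_independent:
  fixes b :: "'i \<Rightarrow> ('m::comm_monoid_add \<Rightarrow>\<^sub>0 'k::field)"
  assumes "finite J" "finite W" and keys: "\<And>j. j \<in> J \<Longrightarrow> Poly_Mapping.keys (b j) \<subseteq> W"
    and indep: "\<And>c j. (\<Sum>j\<in>J. Poly_Mapping.single 0 (c j) * b j) = 0 \<Longrightarrow> j \<in> J \<Longrightarrow> c j = 0"
  shows "card J \<le> card W"
proof -
  interpret V: vector_space "\<lambda>c (q :: 'm \<Rightarrow>\<^sub>0 'k). Poly_Mapping.single 0 c * q"
    by unfold_locales
      (simp_all add: algebra_simps single_add mult_single flip: mult.assoc)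
  have inj: "inj_on b J"
  proof (rule inj_onI, rule ccontr)
    fix i j assume ij: "i \<in> J" "j \<in> J" "b i = b j" "i \<noteq> j"
    \<comment> \<open>Equal vectors at two different indices would satisfy the relation with coefficients 1 and -1.\<close>
    let ?c = "\<lambda>l. if l = i then 1 else if l = j then - 1 else (0::'k)"
    have "(\<Sum>l\<in>J. Poly_Mapping.single 0 (?c l) * b l)
        = (\<Sum>l\<in>J. (if l = i then b l else 0) + (if l = j then - b l else 0))"
      by (intro sum.cong) (use ij(4) in \<open>auto simp: single_uminus\<close>)
    also have "\<dots> = 0" using ij \<open>finite J\<close> by (simp add: sum.distrib)
    finally have "?c i = 0" using indep[of ?c i] ij by simp
    thus False by simp
  qed
  have "V.independent (b ` J)"
  proof (subst V.dependent_finite)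
    show "\<not> (\<exists>u. (\<exists>v\<in>b ` J. u v \<noteq> 0) \<and> (\<Sum>v\<in>b ` J. Poly_Mapping.single 0 (u v) * v) = 0)"
    proof (intro notI, elim exE conjE bexE)
      fix u v assume u: "(\<Sum>v\<in>b ` J. Poly_Mapping.single 0 (u v) * v) = 0" "v \<in> b ` J" "u v \<noteq> 0"
      then obtain j where "j \<in> J" "v = b j" by auto
      thus False using indep[of "\<lambda>j. u (b j)" j] u by (simp add: sum.reindex[OF inj])
    qed
  qed (use \<open>finite J\<close> in simp)
  moreover have "b ` J \<subseteq> V.span ((\<lambda>w. Poly_Mapping.single w 1) ` W)"
  proof (intro image_subsetI)
    fix j assume "j \<in> J"
    have *: "Poly_Mapping.single w a = Poly_Mapping.single 0 a * Poly_Mapping.single w 1"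
      for w :: 'm and a :: 'k by (simp add: mult_single)
    have "(\<Sum>w\<in>Poly_Mapping.keys (b j). Poly_Mapping.single w (Poly_Mapping.lookup (b j) w))
        \<in> V.span ((\<lambda>w. Poly_Mapping.single w 1) ` W)"
    proof (rule V.span_sum)
      fix w assume "w \<in> Poly_Mapping.keys (b j)"
      hence "w \<in> W" using keys[OF \<open>j \<in> J\<close>] by auto
      thus "Poly_Mapping.single w (Poly_Mapping.lookup (b j) w)
          \<in> V.span ((\<lambda>w. Poly_Mapping.single w 1) ` W)"
        by (subst *) (intro V.span_scale V.span_base imageI)
    qed
    thus "b j \<in> V.span ((\<lambda>w. Poly_Mapping.single w 1) ` W)"
      by (subst poly_mapping_sum_single)
  qed
  ultimately have "card (b ` J) \<le> card ((\<lambda>w. Poly_Mapping.single w (1::'k)) ` W)"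
    using V.independent_span_bound \<open>finite W\<close> by blast
  also have "\<dots> \<le> card W" using \<open>finite W\<close> by (rule card_image_le)
  finally show ?thesis by (simp add: card_image[OF inj])
qed

lemma keys_monomial_map: "Poly_Mapping.keys (monomial_map A N q) \<subseteq> A ` Poly_Mapping.keys q"
proof
  fix w assume "w \<in> Poly_Mapping.keys (monomial_map A N q)"
  hence "{m. m \<in> Poly_Mapping.keys q \<and> N m \<and> A m = w} \<noteq> {}"
    unfolding in_keys_iff lookup_monomial_map by (metis sum.empty)
  thus "w \<in> A ` Poly_Mapping.keys q" by auto
qed

definition degree_at_most :: "nat \<Rightarrow> ('v, 'k::field) mpoly \<Rightarrow> bool" where
  "degree_at_most t q \<longleftrightarrow> (\<forall>u\<in>Poly_Mapping.keys q. monom_deg u \<le> t)"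

lemma degree_at_most_mult:
  "degree_at_most s p \<Longrightarrow> degree_at_most t q \<Longrightarrow> degree_at_most (s + t) (p * q)"
  using keys_mult[of p q] unfolding degree_at_most_def
  by (fastforce simp: monom_deg_plus intro: add_mono)

lemma degree_at_most_power: "degree_at_most s p \<Longrightarrow> degree_at_most (a * s) (p ^ a)"
proof (induction a)
  case (Suc a)
  show ?case using degree_at_most_mult[OF Suc.prems Suc.IH[OF Suc.prems]] by simp
qed (simp add: degree_at_most_def)

lemma degree_at_most_prod:
  "(\<And>i. i < m \<Longrightarrow> degree_at_most s (f i)) \<Longrightarrow> degree_at_most (m * s) (\<Prod>i<(m::nat). f i)"
proof (induction m)
  case (Suc m)
  have "degree_at_most (m * s + s) ((\<Prod>i<m. f i) * f m)"
    by (intro degree_at_most_mult Suc) auto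
  thus ?case by (simp add: add.commute)
qed (simp add: degree_at_most_def)

lemma degree_at_most_mono: "degree_at_most s p \<Longrightarrow> s \<le> t \<Longrightarrow> degree_at_most t p"
  by (auto simp: degree_at_most_def)

text \<open>For larger \<open>m\<close> the bound would fail at \<open>d = C\<close>.\<close>

lemma exponent_le_if_power_bounded:
  assumes "\<And>d::nat. (d + 1) ^ m \<le> C * (d + 1) ^ D"
  shows "m \<le> D"
proof (rule ccontr)
  assume "\<not> m \<le> D"
  hence "Suc D \<le> m" by simp
  hence "(C + 1) ^ Suc D \<le> (C + 1) ^ m" by (rule power_increasing) simp
  also have "\<dots> \<le> C * (C + 1) ^ D" by (rule assms)
  finally show False by simp
qed

text \<open>Up to degree \<open>m b d\<close>, where \<open>b\<close> bounds the degrees of the elements \<open>f i\<close>, the ring modulo \<open>Q 0\<close>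
  contains the \<open>(d + 1)^m\<close> independent products of powers of the \<open>f i\<close> with exponents at most \<open>d\<close>.
  Growth of order \<open>D\<close> leaves no room for that if \<open>m > D\<close>.\<close>

lemma prime_chain_length_le:
  fixes A :: "('v \<Rightarrow>\<^sub>0 nat) \<Rightarrow> 'm::comm_monoid_add"
    and Q :: "nat \<Rightarrow> ('v, 'k::field) mpoly set"
  assumes A: "\<And>u v. A (u + v) = A u + A v" and A0: "A 0 = 0"
    and prime: "\<And>i. i \<le> m \<Longrightarrow> primeideal (Q i) (poly_ring X)"
    and strict: "\<And>i. i < m \<Longrightarrow> Q i \<subset> Q (Suc i)"
    and above: "toric_kernel X A (\<lambda>_. True) \<subseteq> Q 0"
    and fin: "\<And>t. finite (A ` {u. Poly_Mapping.keys u \<subseteq> X \<and> monom_deg u \<le> t})"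
    and growth: "\<And>t. card (A ` {u. Poly_Mapping.keys u \<subseteq> X \<and> monom_deg u \<le> t}) \<le> C * (t + 1) ^ D"
  shows "m \<le> D"
proof -
  have "\<forall>i\<in>{..<m}. \<exists>g. g \<in> Q (Suc i) - Q i" using strict by auto
  then obtain f where f: "\<And>i. i < m \<Longrightarrow> f i \<in> Q (Suc i) - Q i"
    by (auto dest!: bchoice)
  have carr: "f i \<in> carrier (poly_ring X)" if "i < m" for i
    using ideal.Icarr[OF primeideal.axioms(1)[OF prime[of "Suc i"]], of "f i"] f[OF that] that
    by simp
  define b where "b = Max (insert 0 (monom_deg ` (\<Union>i<m. Poly_Mapping.keys (f i))))"
  have b: "degree_at_most b (f i)" if "i < m" for i
    unfolding degree_at_most_def b_def using that by (intro ballI Max_ge) auto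
  have "(d + 1) ^ m \<le> (C * (m * b + 1) ^ D) * (d + 1) ^ D" for d
  proof -
    let ?L = "{as. set as \<subseteq> {..d} \<and> length as = m}"
    let ?W = "A ` {u. Poly_Mapping.keys u \<subseteq> X \<and> monom_deg u \<le> m * (d * b)}"
    let ?g = "\<lambda>as. \<Prod>i<m. f i ^ (as ! i)"
    let ?\<phi> = "monomial_map A (\<lambda>_. True) :: ('v, 'k) mpoly \<Rightarrow> _"
    have g_closed: "?g as \<in> carrier (poly_ring X)" for as
      by (intro poly_ring_prod_closed poly_ring_power_closed carr) simp
    have "card ?L \<le> card ?W"
    proof (rule card_le_keys_if_independent[where b = "\<lambda>as. ?\<phi> (?g as)"])
      show "finite ?L" by (rule finite_lists_length_eq) simp
      show "finite ?W" by (rule fin)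
      show "Poly_Mapping.keys (?\<phi> (?g as)) \<subseteq> ?W" if "as \<in> ?L" for as
      proof -
        have "degree_at_most (m * (d * b)) (?g as)"
        proof (rule degree_at_most_prod)
          fix i assume "i < m"
          hence "as ! i \<le> d" using that by (metis (mono_tags) atMost_iff mem_Collect_eq nth_mem subsetD)
          thus "degree_at_most (d * b) (f i ^ (as ! i))"
            using degree_at_most_mono[OF degree_at_most_power[OF b[OF \<open>i < m\<close>]]] by simp
        qed
        hence "Poly_Mapping.keys (?g as) \<subseteq> {u. Poly_Mapping.keys u \<subseteq> X \<and> monom_deg u \<le> m * (d * b)}"
          using g_closed[of as] by (auto simp: degree_at_most_def poly_ring_carrier)
        thus ?thesis using keys_monomial_map[of A "\<lambda>_. True" "?g as"] by blast
      qed
      show "c as = 0" if zero: "(\<Sum>as\<in>?L. Poly_Mapping.single 0 (c as) * ?\<phi> (?g as)) = 0"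
        and as: "as \<in> ?L" for c as
      proof (rule prime_chain_monomials_independent[where Q = Q and f = f and m = m and d = d and c = c])
        let ?s = "\<Sum>as\<in>?L. Const (c as) * ?g as"
        have "?\<phi> ?s = 0"
          using zero by (simp add: monomial_map_sum monomial_map_mult A Const_def monomial_map_single A0)
        moreover have "?s \<in> carrier (poly_ring X)"
          by (intro poly_ring_sum_closed poly_ring_mult_closed poly_ring_Const_closed g_closed)
        ultimately show "?s \<in> Q 0" using above by (auto simp: toric_kernel_def)
      qed (use prime strict f as in auto)
    qed
    also have "\<dots> \<le> C * (m * (d * b) + 1) ^ D" by (rule growth)
    also have "\<dots> \<le> C * ((m * b + 1) * (d + 1)) ^ D"
      by (intro mult_left_mono power_mono) (auto simp: algebra_simps)
    also have "card ?L = (d + 1) ^ m" by (simp add: card_lists_length_eq)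
    finally show ?thesis by (simp only: power_mult_distrib mult.assoc)
  qed
  thus ?thesis by (rule exponent_le_if_power_bounded)
qed

section \<open>Counting monomials\<close>

definition monomials :: "'v set \<Rightarrow> ('v \<Rightarrow>\<^sub>0 nat) set" where
  "monomials X = {u. Poly_Mapping.keys u \<subseteq> X}"

definition monomial_series :: "('v \<Rightarrow>\<^sub>0 nat) set \<Rightarrow> int fps" where
  "monomial_series M = Abs_fps (\<lambda>d. int (card {u \<in> M. monom_deg u = d}))"

definition squarefree_monomial :: "'v set \<Rightarrow> ('v \<Rightarrow>\<^sub>0 nat)" where
  "squarefree_monomial S = (\<Sum>x\<in>S. Poly_Mapping.single x 1)"

lemma lookup_squarefree_monomial:
  "finite S \<Longrightarrow> Poly_Mapping.lookup (squarefree_monomial S) x = (if x \<in> S then 1 else 0)"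
  by (simp add: squarefree_monomial_def lookup_sum lookup_single when_def)

lemma keys_squarefree_monomial: "finite S \<Longrightarrow> Poly_Mapping.keys (squarefree_monomial S) = S"
  by (auto simp: in_keys_iff lookup_squarefree_monomial split: if_splits)

lemma monom_deg_squarefree_monomial: "finite S \<Longrightarrow> monom_deg (squarefree_monomial S) = card S"
  by (simp add: monom_deg_def keys_squarefree_monomial lookup_squarefree_monomial)

lemma squarefree_monomial_dividesE:
  assumes "finite S" and "\<And>x. x \<in> S \<Longrightarrow> Poly_Mapping.lookup u x \<noteq> 0"
  obtains v where "u = squarefree_monomial S + v"
proof
  show "u = squarefree_monomial S + (u - squarefree_monomial S)"
  proof (rule poly_mapping_eqI)
    fix x
    show "Poly_Mapping.lookup u x =
        Poly_Mapping.lookup (squarefree_monomial S + (u - squarefree_monomial S)) x"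
      using assms(2)[of x]
      by (simp add: lookup_add minus_poly_mapping.rep_eq lookup_squarefree_monomial[OF assms(1)])
  qed
qed

lemma card_bounded_exponents:
  assumes "finite Y"
  shows "finite {u :: 'v \<Rightarrow>\<^sub>0 nat. Poly_Mapping.keys u \<subseteq> Y \<and> (\<forall>x. Poly_Mapping.lookup u x \<le> t)}"
      (is "finite ?U")
    and "card {u :: 'v \<Rightarrow>\<^sub>0 nat. Poly_Mapping.keys u \<subseteq> Y \<and> (\<forall>x. Poly_Mapping.lookup u x \<le> t)}
      \<le> (t + 1) ^ card Y"
proof -
  let ?r = "\<lambda>u :: 'v \<Rightarrow>\<^sub>0 nat. restrict (Poly_Mapping.lookup u) Y"
  have inj: "inj_on ?r ?U"
  proof (rule inj_onI)
    fix u v assume uv: "u \<in> ?U" "v \<in> ?U" and eq: "?r u = ?r v"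
    show "u = v"
    proof (rule poly_mapping_eqI)
      fix x
      show "Poly_Mapping.lookup u x = Poly_Mapping.lookup v x"
      proof (cases "x \<in> Y")
        case True
        thus ?thesis using fun_cong[OF eq, of x] by simp
      next
        case False
        hence "x \<notin> Poly_Mapping.keys u" "x \<notin> Poly_Mapping.keys v" using uv by auto
        thus ?thesis by (simp add: in_keys_iff)
      qed
    qed
  qed
  have sub: "?r ` ?U \<subseteq> (\<Pi>\<^sub>E x\<in>Y. {..t})" by auto
  have fin: "finite (\<Pi>\<^sub>E x\<in>Y. {..t})" by (rule finite_PiE) (use assms in auto)
  show "finite ?U" by (rule inj_on_finite[OF inj sub fin])
  have "card ?U \<le> card (\<Pi>\<^sub>E x\<in>Y. {..t})" by (rule card_inj_on_le[OF inj sub fin])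
  thus "card ?U \<le> (t + 1) ^ card Y" using assms by (simp add: card_PiE)
qed

lemma lookup_le_monom_deg: "Poly_Mapping.lookup u x \<le> monom_deg u"
proof (cases "x \<in> Poly_Mapping.keys u")
  case True
  thus ?thesis unfolding monom_deg_def by (intro member_le_sum) auto
qed (simp add: in_keys_iff)

lemma finite_monomials_degree_le:
  assumes "finite X"
  shows "finite {u \<in> monomials X. monom_deg u \<le> t}"
  by (rule finite_subset[OF _ card_bounded_exponents(1)[OF assms, of t]])
    (auto simp: monomials_def intro: order_trans[OF lookup_le_monom_deg])

text \<open>If \<open>M'\<close> consists of the members of \<open>M\<close> not divisible by \<open>s\<close>, then multiplication by \<open>s\<close> is a
  bijection from \<open>M\<close> to the other members and raises degrees by the degree of \<open>s\<close>. Applied with a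
  variable as \<open>s\<close> this counts all monomials; applied with the product of the even variables of a
  block it counts normal forms.\<close>

lemma monomial_series_not_divisible:
  assumes fin: "\<And>d. finite {u \<in> M. monom_deg u = d}" and "M' \<subseteq> M"
    and shift: "\<And>v. v \<in> M \<Longrightarrow> s + v \<in> M - M'"
    and split: "\<And>u. u \<in> M - M' \<Longrightarrow> \<exists>v\<in>M. u = s + v"
  shows "monomial_series M' = (1 - fps_X ^ monom_deg s) * monomial_series M"
proof (rule fps_ext)
  fix d
  let ?deg = "\<lambda>M d. {u \<in> M. monom_deg u = d}"
  have diff: "?deg (M - M') d = (if d < monom_deg s then {} else (+) s ` ?deg M (d - monom_deg s))"
  proof (intro equalityI subsetI)
    fix u assume u: "u \<in> ?deg (M - M') d"
    then obtain v where "v \<in> M" "u = s + v" using split by blast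
    thus "u \<in> (if d < monom_deg s then {} else (+) s ` ?deg M (d - monom_deg s))"
      using u by (auto simp: monom_deg_plus)
  next
    fix u assume "u \<in> (if d < monom_deg s then {} else (+) s ` ?deg M (d - monom_deg s))"
    then obtain v where "v \<in> M" "u = s + v" "monom_deg s + monom_deg v = d"
      by (auto split: if_splits)
    thus "u \<in> ?deg (M - M') d" using shift by (auto simp: monom_deg_plus)
  qed
  have "card (?deg M d) = card (?deg M' d \<union> ?deg (M - M') d)"
    using \<open>M' \<subseteq> M\<close> by (intro arg_cong[where f = card]) auto
  also have "\<dots> = card (?deg M' d) + card (?deg (M - M') d)"
    by (rule card_Un_disjoint) (use \<open>M' \<subseteq> M\<close> in \<open>auto intro: finite_subset[OF _ fin[of d]]\<close>)
  also have "card (?deg (M - M') d) = (if d < monom_deg s then 0 else card (?deg M (d - monom_deg s)))"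
    unfolding diff by (simp add: card_image)
  finally show "fps_nth (monomial_series M') d
      = fps_nth ((1 - fps_X ^ monom_deg s) * monomial_series M) d"
    by (simp add: monomial_series_def left_diff_distrib fps_X_power_mult_nth)
qed

lemma monomial_series_all:
  fixes X :: "'v set"
  assumes "finite X"
  shows "monomial_series (monomials X) * (1 - fps_X) ^ card X = 1"
  using assms
proof (induction X rule: finite_induct)
  case empty
  have "monomials {} = {0 :: 'v \<Rightarrow>\<^sub>0 nat}" by (auto simp: monomials_def)
  hence "{u \<in> monomials {}. monom_deg u = d} = (if d = 0 then {0 :: 'v \<Rightarrow>\<^sub>0 nat} else {})" for d
    by auto
  thus ?case by (auto simp: monomial_series_def fps_eq_iff)
next
  case (insert x X)
  let ?s = "squarefree_monomial {x}"
  have "monomial_series (monomials X)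
      = (1 - fps_X ^ monom_deg ?s) * monomial_series (monomials (insert x X))"
  proof (rule monomial_series_not_divisible)
    show "finite {u \<in> monomials (insert x X). monom_deg u = d}" for d
      by (rule finite_subset[OF _ finite_monomials_degree_le[of "insert x X" d]])
        (use insert.hyps in auto)
    show "?s + v \<in> monomials (insert x X) - monomials X" if "v \<in> monomials (insert x X)" for v
      using that insert.hyps by (auto simp: monomials_def keys_plus_nat keys_squarefree_monomial)
    fix u assume u: "u \<in> monomials (insert x X) - monomials X"
    hence "Poly_Mapping.lookup u x \<noteq> 0" by (auto simp: monomials_def in_keys_iff)
    then obtain v where "u = ?s + v" using squarefree_monomial_dividesE[of "{x}" u] by auto
    thus "\<exists>v\<in>monomials (insert x X). u = ?s + v"
      using u by (auto simp: monomials_def keys_plus_nat)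
  qed (auto simp: monomials_def)
  hence "monomial_series (monomials X) = (1 - fps_X) * monomial_series (monomials (insert x X))"
    by (simp add: monom_deg_squarefree_monomial)
  thus ?case using insert by (simp add: mult_ac)
qed

section \<open>Lattice ideals of disjoint balanced blocks\<close>

text \<open>The variables fall into disjoint blocks, each with \<open>e\<close> even and \<open>e\<close> odd variables. The last
  assumption says that two monomials have the same image if and only if they differ, block by block,
  by a power of (product of the even variables) / (product of the odd variables). The kernel is
  therefore a prime ideal containing one binomial of degree \<open>e\<close> for each block.\<close>

locale binomial_blocks =
  fixes X :: "'v set" and Bs :: "'b set" and Ev Od :: "'b \<Rightarrow> 'v set" and e :: nat
    and A :: "('v \<Rightarrow>\<^sub>0 nat) \<Rightarrow> 'm::{ordered_cancel_comm_monoid_add, linorder}"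
  assumes X_eq: "X = (\<Union>B\<in>Bs. Ev B \<union> Od B)"
    and finite_Bs: "finite Bs" and e_pos: "e \<ge> 1"
    and finite_Ev: "\<And>B. B \<in> Bs \<Longrightarrow> finite (Ev B)" and finite_Od: "\<And>B. B \<in> Bs \<Longrightarrow> finite (Od B)"
    and card_Ev: "\<And>B. B \<in> Bs \<Longrightarrow> card (Ev B) = e" and card_Od: "\<And>B. B \<in> Bs \<Longrightarrow> card (Od B) = e"
    and Ev_Od: "\<And>B C. B \<in> Bs \<Longrightarrow> C \<in> Bs \<Longrightarrow> Ev B \<inter> Od C = {}"
    and Ev_Ev: "\<And>B C. B \<in> Bs \<Longrightarrow> C \<in> Bs \<Longrightarrow> B \<noteq> C \<Longrightarrow> Ev B \<inter> Ev C = {}"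
    and Od_Od: "\<And>B C. B \<in> Bs \<Longrightarrow> C \<in> Bs \<Longrightarrow> B \<noteq> C \<Longrightarrow> Od B \<inter> Od C = {}"
    and A_add: "\<And>u v. A (u + v) = A u + A v"
    and fibres: "\<And>u v. u \<in> monomials X \<Longrightarrow> v \<in> monomials X \<Longrightarrow>
      A u = A v \<longleftrightarrow> (\<forall>B\<in>Bs. \<exists>c::int.
        (\<forall>x\<in>Ev B. int (Poly_Mapping.lookup u x) = int (Poly_Mapping.lookup v x) + c) \<and>
        (\<forall>y\<in>Od B. int (Poly_Mapping.lookup u y) = int (Poly_Mapping.lookup v y) - c))"
begin

lemma A_zero: "A 0 = 0"
  using A_add[of 0 0] add_left_cancel[of "A 0" "A 0" 0] by simp

lemma finite_X: "finite X"
  using finite_Bs finite_Ev finite_Od by (auto simp: X_eq)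

lemma card_X: "card X = 2 * e * card Bs"
proof -
  have "card X = (\<Sum>B\<in>Bs. card (Ev B \<union> Od B))"
    unfolding X_eq
  proof (rule card_UN_disjoint)
    show "\<forall>B\<in>Bs. \<forall>C\<in>Bs. B \<noteq> C \<longrightarrow> (Ev B \<union> Od B) \<inter> (Ev C \<union> Od C) = {}"
    proof (intro ballI impI)
      fix B C assume "B \<in> Bs" "C \<in> Bs" "B \<noteq> C"
      thus "(Ev B \<union> Od B) \<inter> (Ev C \<union> Od C) = {}"
        using Ev_Od[of B C] Ev_Od[of C B] Ev_Ev[of B C] Od_Od[of B C] by blast
    qed
  qed (use finite_Bs finite_Ev finite_Od in auto)
  also have "\<dots> = (\<Sum>B\<in>Bs. 2 * e)"
    by (intro sum.cong refl, subst card_Un_disjoint)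
      (auto simp: finite_Ev finite_Od Ev_Od card_Ev card_Od)
  finally show ?thesis by simp
qed

section \<open>Normal forms\<close>

text \<open>A normal form is divisible by none of the products of all even variables of a block. The set \<open>C\<close>
  of blocks for which this is required varies, so that generating functions can be computed by
  adding one block at a time.\<close>

definition normal_forms :: "'b set \<Rightarrow> ('v \<Rightarrow>\<^sub>0 nat) set" where
  "normal_forms C = {u \<in> monomials X. \<forall>B\<in>C. \<exists>x\<in>Ev B. Poly_Mapping.lookup u x = 0}"

lemma A_even_odd:
  assumes "B \<in> Bs"
  shows "A (squarefree_monomial (Ev B)) = A (squarefree_monomial (Od B))"
proof (subst fibres)
  show "squarefree_monomial (Ev B) \<in> monomials X" "squarefree_monomial (Od B) \<in> monomials X"
    using assms by (auto simp: monomials_def keys_squarefree_monomial finite_Ev finite_Od X_eq)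
  show "\<forall>C\<in>Bs. \<exists>c::int.
      (\<forall>x\<in>Ev C. int (Poly_Mapping.lookup (squarefree_monomial (Ev B)) x)
        = int (Poly_Mapping.lookup (squarefree_monomial (Od B)) x) + c) \<and>
      (\<forall>y\<in>Od C. int (Poly_Mapping.lookup (squarefree_monomial (Ev B)) y)
        = int (Poly_Mapping.lookup (squarefree_monomial (Od B)) y) - c)"
  proof
    fix C assume C: "C \<in> Bs"
    have "Ev C \<inter> Od B = {}" "Ev B \<inter> Od C = {}" using C assms Ev_Od by auto
    moreover have "C \<noteq> B \<Longrightarrow> Ev C \<inter> Ev B = {} \<and> Od C \<inter> Od B = {}" using C assms Ev_Ev Od_Od by auto
    ultimately show "\<exists>c::int.
      (\<forall>x\<in>Ev C. int (Poly_Mapping.lookup (squarefree_monomial (Ev B)) x)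
        = int (Poly_Mapping.lookup (squarefree_monomial (Od B)) x) + c) \<and>
      (\<forall>y\<in>Od C. int (Poly_Mapping.lookup (squarefree_monomial (Ev B)) y)
        = int (Poly_Mapping.lookup (squarefree_monomial (Od B)) y) - c)"
      using assms by (intro exI[of _ "if C = B then 1 else 0"])
        (auto simp: lookup_squarefree_monomial finite_Ev finite_Od)
  qed
qed

text \<open>Replacing the product of the even variables of a block by the product of the odd ones preserves
  image and degree and lowers the degree in the even variables.\<close>

lemma exists_normal_form:
  assumes "u \<in> monomials X"
  shows "\<exists>v\<in>normal_forms Bs. A v = A u \<and> monom_deg v = monom_deg u"
  using assms
proof (induction "\<Sum>x\<in>(\<Union>B\<in>Bs. Ev B). Poly_Mapping.lookup u x" arbitrary: u rule: less_induct)
  case less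
  let ?E = "\<Union>B\<in>Bs. Ev B"
  show ?case
  proof (cases "u \<in> normal_forms Bs")
    case False
    then obtain B where B: "B \<in> Bs" and "\<And>x. x \<in> Ev B \<Longrightarrow> Poly_Mapping.lookup u x \<noteq> 0"
      using less.prems by (auto simp: normal_forms_def)
    then obtain w where w: "u = squarefree_monomial (Ev B) + w"
      using squarefree_monomial_dividesE[OF finite_Ev] by metis
    define u' where "u' = squarefree_monomial (Od B) + w"
    have u': "u' \<in> monomials X"
      using less.prems B unfolding u'_def w monomials_def
      by (auto simp: keys_plus_nat keys_squarefree_monomial finite_Od X_eq)
    have Od: "Od B \<inter> ?E = {}" using Ev_Od B by blast
    obtain x where x: "x \<in> Ev B" using card_Ev[OF B] e_pos by fastforce
    have "(\<Sum>x\<in>?E. Poly_Mapping.lookup u' x) < (\<Sum>x\<in>?E. Poly_Mapping.lookup u x)"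
    proof (rule sum_strict_mono_ex1)
      show "finite ?E" using finite_Bs finite_Ev by auto
      show "\<forall>x\<in>?E. Poly_Mapping.lookup u' x \<le> Poly_Mapping.lookup u x"
        using Od by (auto simp: u'_def w lookup_add lookup_squarefree_monomial finite_Od B)
      show "\<exists>x\<in>?E. Poly_Mapping.lookup u' x < Poly_Mapping.lookup u x"
        using Od x B by (intro bexI[of _ x])
          (auto simp: u'_def w lookup_add lookup_squarefree_monomial finite_Od finite_Ev)
    qed
    from less.hyps[OF this u'] obtain v
      where "v \<in> normal_forms Bs" "A v = A u'" "monom_deg v = monom_deg u'" by auto
    moreover have "A u' = A u" by (simp add: u'_def w A_add A_even_odd[OF B])
    moreover have "monom_deg u' = monom_deg u"
      by (simp add: u'_def w monom_deg_plus monom_deg_squarefree_monomial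
          finite_Ev finite_Od B card_Ev card_Od)
    ultimately show ?thesis by auto
  qed auto
qed

text \<open>The shift \<open>c\<close> between two normal forms with the same image vanishes on every block: each of
  them has an even variable of exponent 0, which forces \<open>c \<le> 0\<close> and \<open>c \<ge> 0\<close>.\<close>

lemma normal_form_unique: "inj_on A (normal_forms Bs)"
proof (rule inj_onI)
  fix u v assume uv: "u \<in> normal_forms Bs" "v \<in> normal_forms Bs" and eq: "A u = A v"
  have mons: "u \<in> monomials X" "v \<in> monomials X" using uv by (auto simp: normal_forms_def)
  have block: "Poly_Mapping.lookup u x = Poly_Mapping.lookup v x" if "B \<in> Bs" "x \<in> Ev B \<union> Od B" for B x
  proof -
    obtain c :: int where
      c: "\<And>x. x \<in> Ev B \<Longrightarrow> int (Poly_Mapping.lookup u x) = int (Poly_Mapping.lookup v x) + c"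
        "\<And>y. y \<in> Od B \<Longrightarrow> int (Poly_Mapping.lookup u y) = int (Poly_Mapping.lookup v y) - c"
      using eq fibres[OF mons] \<open>B \<in> Bs\<close> by blast
    obtain x1 x2 where "x1 \<in> Ev B" "Poly_Mapping.lookup u x1 = 0"
      "x2 \<in> Ev B" "Poly_Mapping.lookup v x2 = 0"
      using uv \<open>B \<in> Bs\<close> unfolding normal_forms_def by blast
    hence "c = 0" using c(1)[of x1] c(1)[of x2] by simp
    thus ?thesis using c that by auto
  qed
  show "u = v"
  proof (rule poly_mapping_eqI)
    fix x
    show "Poly_Mapping.lookup u x = Poly_Mapping.lookup v x"
    proof (cases "x \<in> X")
      case True
      thus ?thesis using block by (auto simp: X_eq)
    next
      case False
      hence "x \<notin> Poly_Mapping.keys u" "x \<notin> Poly_Mapping.keys v" using mons by (auto simp: monomials_def)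
      thus ?thesis by (simp add: in_keys_iff)
    qed
  qed
qed

lemma image_A_normal_forms:
  "A ` {u \<in> monomials X. P (monom_deg u)} = A ` {u \<in> normal_forms Bs. P (monom_deg u)}"
proof (intro equalityI subsetI)
  fix w assume "w \<in> A ` {u \<in> monomials X. P (monom_deg u)}"
  then obtain u where u: "u \<in> monomials X" "P (monom_deg u)" "w = A u" by auto
  then obtain v where "v \<in> normal_forms Bs" "A v = A u" "monom_deg v = monom_deg u"
    using exists_normal_form by blast
  thus "w \<in> A ` {u \<in> normal_forms Bs. P (monom_deg u)}" using u by (metis (mono_tags) imageI mem_Collect_eq)
qed (auto simp: normal_forms_def)

text \<open>Dividing by the product of the even variables of \<open>B\<close> leaves the conditions for other blocks
  intact, because the blocks are disjoint.\<close>

lemma normal_forms_series: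
  assumes "C \<subseteq> Bs"
  shows "monomial_series (normal_forms C) = (1 - fps_X ^ e) ^ card C * monomial_series (monomials X)"
  using finite_subset[OF assms finite_Bs] assms
proof (induction C rule: finite_induct)
  case empty
  have "normal_forms {} = monomials X" by (auto simp: normal_forms_def)
  thus ?case by simp
next
  case (insert B C)
  have B: "B \<in> Bs" and C: "C \<subseteq> Bs" using insert.prems by auto
  let ?s = "squarefree_monomial (Ev B)"
  have s: "Poly_Mapping.lookup ?s x = (if x \<in> Ev B then 1 else 0)" for x
    by (rule lookup_squarefree_monomial[OF finite_Ev[OF B]])
  have other: "Poly_Mapping.lookup ?s x = 0" if "x \<in> Ev B'" "B' \<in> C" for x B'
  proof -
    have "Ev B \<inter> Ev B' = {}" using Ev_Ev[of B B'] that insert.hyps B C by auto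
    thus ?thesis using that by (auto simp: s)
  qed
  have add: "?s + v \<in> normal_forms C \<longleftrightarrow> v \<in> normal_forms C" for v
  proof -
    have "?s + v \<in> monomials X \<longleftrightarrow> v \<in> monomials X"
      using B by (auto simp: monomials_def keys_plus_nat keys_squarefree_monomial finite_Ev X_eq)
    moreover have "(\<exists>x\<in>Ev B'. Poly_Mapping.lookup (?s + v) x = 0)
        \<longleftrightarrow> (\<exists>x\<in>Ev B'. Poly_Mapping.lookup v x = 0)" if "B' \<in> C" for B'
      using other[OF _ that] by (auto simp: lookup_add)
    ultimately show ?thesis by (simp add: normal_forms_def)
  qed
  have "monomial_series (normal_forms (insert B C))
      = (1 - fps_X ^ monom_deg ?s) * monomial_series (normal_forms C)"
  proof (rule monomial_series_not_divisible)
    show "finite {u \<in> normal_forms C. monom_deg u = d}" for d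
      by (rule finite_subset[OF _ finite_monomials_degree_le[OF finite_X, of d]])
        (auto simp: normal_forms_def)
    show "?s + v \<in> normal_forms C - normal_forms (insert B C)" if "v \<in> normal_forms C" for v
    proof
      show "?s + v \<in> normal_forms C" using that add by simp
      show "?s + v \<notin> normal_forms (insert B C)"
      proof
        assume "?s + v \<in> normal_forms (insert B C)"
        then obtain x where "x \<in> Ev B" "Poly_Mapping.lookup (?s + v) x = 0"
          unfolding normal_forms_def by blast
        thus False by (simp add: lookup_add s)
      qed
    qed
    fix u assume u: "u \<in> normal_forms C - normal_forms (insert B C)"
    have "Poly_Mapping.lookup u x \<noteq> 0" if "x \<in> Ev B" for x
    proof
      assume "Poly_Mapping.lookup u x = 0"
      hence "u \<in> normal_forms (insert B C)" using u that by (auto simp: normal_forms_def)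
      thus False using u by simp
    qed
    then obtain v where v: "u = ?s + v"
      by (rule squarefree_monomial_dividesE[OF finite_Ev[OF B]])
    hence "v \<in> normal_forms C" using u add by simp
    thus "\<exists>v\<in>normal_forms C. u = ?s + v" using v by blast
  qed (auto simp: normal_forms_def)
  thus ?case
    using insert C by (simp add: monom_deg_squarefree_monomial finite_Ev card_Ev B mult.assoc)
qed

text \<open>A normal form misses at least one even variable from each block. For a fixed choice \<open>f\<close> of the
  missing variables there are \<open>card X - card Bs\<close> exponents left to choose.\<close>

lemma normal_forms_growth:
  "card {u \<in> normal_forms Bs. monom_deg u \<le> t} \<le> e ^ card Bs * (t + 1) ^ (card Bs * (2 * e - 1))"
proof -
  let ?choices = "\<Pi>\<^sub>E B\<in>Bs. Ev B"
  let ?box = "\<lambda>f. {u. Poly_Mapping.keys u \<subseteq> X - f ` Bs \<and> (\<forall>x. Poly_Mapping.lookup u x \<le> t)}"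
  have finc: "finite ?choices" by (rule finite_PiE[OF finite_Bs finite_Ev])
  have "{u \<in> normal_forms Bs. monom_deg u \<le> t} \<subseteq> (\<Union>f\<in>?choices. ?box f)"
  proof
    fix u assume u: "u \<in> {u \<in> normal_forms Bs. monom_deg u \<le> t}"
    hence "\<forall>B\<in>Bs. \<exists>x. x \<in> Ev B \<and> Poly_Mapping.lookup u x = 0" by (auto simp: normal_forms_def)
    then obtain f where f: "\<And>B. B \<in> Bs \<Longrightarrow> f B \<in> Ev B \<and> Poly_Mapping.lookup u (f B) = 0"
      by (auto dest!: bchoice)
    have "restrict f Bs \<in> ?choices" using f by auto
    moreover have "u \<in> ?box (restrict f Bs)"
      using u f by (auto simp: normal_forms_def monomials_def in_keys_iff
          intro: order_trans[OF lookup_le_monom_deg])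
    ultimately show "u \<in> (\<Union>f\<in>?choices. ?box f)" by blast
  qed
  hence "card {u \<in> normal_forms Bs. monom_deg u \<le> t} \<le> card (\<Union>f\<in>?choices. ?box f)"
    by (intro card_mono finite_UN_I finc card_bounded_exponents(1)) (use finite_X in auto)
  also have "\<dots> \<le> (\<Sum>f\<in>?choices. card (?box f))" by (rule card_UN_le[OF finc])
  also have "\<dots> \<le> (\<Sum>f\<in>?choices. (t + 1) ^ (card Bs * (2 * e - 1)))"
  proof (rule sum_mono)
    fix f assume f: "f \<in> ?choices"
    have "inj_on f Bs"
    proof (rule inj_onI, rule ccontr)
      fix B C assume "B \<in> Bs" "C \<in> Bs" "f B = f C" "B \<noteq> C"
      thus False using f Ev_Ev[of B C] by (metis PiE_mem disjoint_iff)
    qed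
    hence "card (f ` Bs) = card Bs" by (rule card_image)
    moreover have "f ` Bs \<subseteq> X" using f by (auto simp: X_eq)
    ultimately have "card (X - f ` Bs) = card Bs * (2 * e - 1)"
      using finite_Bs by (simp add: card_Diff_subset card_X algebra_simps diff_mult_distrib2)
    thus "card (?box f) \<le> (t + 1) ^ (card Bs * (2 * e - 1))"
      using card_bounded_exponents(2)[of "X - f ` Bs" t] finite_X by simp
  qed
  also have "\<dots> = e ^ card Bs * (t + 1) ^ (card Bs * (2 * e - 1))"
    using finite_Bs by (simp add: card_PiE card_Ev)
  finally show ?thesis .
qed

section \<open>A saturated chain of primes\<close>

text \<open>Setting the variables in \<open>Z\<close> to 0 is compatible with the binomials if every block is either
  untouched or loses both of its products.\<close>

definition admissible :: "'v set \<Rightarrow> bool" where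
  "admissible Z \<longleftrightarrow> (\<forall>B\<in>Bs. Z \<inter> (Ev B \<union> Od B) = {} \<or> (Z \<inter> Ev B \<noteq> {} \<and> Z \<inter> Od B \<noteq> {}))"

abbreviation avoids :: "'v set \<Rightarrow> ('v \<Rightarrow>\<^sub>0 nat) \<Rightarrow> bool" where
  "avoids Z u \<equiv> Poly_Mapping.keys u \<inter> Z = {}"

text \<open>If a block meets \<open>Z\<close>, then \<open>u\<close> has exponent 0 at an even and at an odd variable of
  that block. The corresponding exponents \<open>-c\<close> and \<open>c\<close> of \<open>v\<close> are nonnegative, so \<open>c = 0\<close> and \<open>u\<close>
  and \<open>v\<close> agree on the block.\<close>

lemma admissible_fibre:
  assumes Z: "admissible Z" and mons: "u \<in> monomials X" "v \<in> monomials X"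
    and eq: "A u = A v" and u: "avoids Z u"
  shows "avoids Z v"
proof (rule ccontr)
  assume "\<not> avoids Z v"
  then obtain x where x: "x \<in> Poly_Mapping.keys v" "x \<in> Z" by auto
  then obtain B where B: "B \<in> Bs" "x \<in> Ev B \<union> Od B" using mons by (auto simp: monomials_def X_eq)
  then obtain x0 y0 where xy: "x0 \<in> Z" "x0 \<in> Ev B" "y0 \<in> Z" "y0 \<in> Od B"
    using Z x unfolding admissible_def by blast
  obtain c :: int where
    c: "\<And>x. x \<in> Ev B \<Longrightarrow> int (Poly_Mapping.lookup u x) = int (Poly_Mapping.lookup v x) + c"
      "\<And>y. y \<in> Od B \<Longrightarrow> int (Poly_Mapping.lookup u y) = int (Poly_Mapping.lookup v y) - c"
    using eq fibres[OF mons] B(1) by blast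
  have zero: "Poly_Mapping.lookup u z = 0" if "z \<in> Z" for z
    using u that by (auto simp: in_keys_iff)
  have "c = 0" using c(1)[of x0] c(2)[of y0] xy zero by simp
  hence "Poly_Mapping.lookup v x = 0" using c(1)[of x] c(2)[of x] B(2) zero[OF x(2)] by auto
  thus False using x(1) by (simp add: in_keys_iff)
qed

lemma toric_kernel_mono:
  assumes "admissible Z'" "Z \<subseteq> Z'"
  shows "toric_kernel X A (avoids Z) \<subseteq> toric_kernel X A (avoids Z')"
proof
  fix q assume q: "q \<in> toric_kernel X A (avoids Z)"
  have "monomial_map A (avoids Z') q = 0"
  proof (rule monomial_map_eq_0_transfer)
    show "monomial_map A (avoids Z) q = 0" using q by (simp add: toric_kernel_def)
    fix u v assume uv: "u \<in> Poly_Mapping.keys q" "v \<in> Poly_Mapping.keys q" "avoids Z' u"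
    hence "u \<in> monomials X" "v \<in> monomials X"
      using q by (auto simp: toric_kernel_def poly_ring_carrier monomials_def)
    hence "A u = A v \<Longrightarrow> avoids Z' v" using admissible_fibre[OF assms(1)] uv(3) by blast
    thus "A u = A v \<and> avoids Z' v \<longleftrightarrow> A u = A v \<and> avoids Z v" using assms(2) by blast
  qed
  thus "q \<in> toric_kernel X A (avoids Z')" using q by (simp add: toric_kernel_def)
qed

text \<open>A variable in \<open>Z'\<close> but not in \<open>Z\<close> separates the two kernels.\<close>

lemma toric_kernel_strict_mono:
  assumes "admissible Z'" "Z \<subset> Z'" "Z' \<subseteq> X"
  shows "(toric_kernel X A (avoids Z) :: ('v, 'k::field) mpoly set) \<subset> toric_kernel X A (avoids Z')"
proof
  show "(toric_kernel X A (avoids Z) :: ('v, 'k) mpoly set) \<subseteq> toric_kernel X A (avoids Z')"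
    by (rule toric_kernel_mono) (use assms in auto)
  obtain x where x: "x \<in> Z'" "x \<notin> Z" using assms by auto
  have "Poly_Mapping.single (A (Poly_Mapping.single x 1)) (1::'k) \<noteq> 0"
    by (metis lookup_single_eq lookup_zero one_neq_zero)
  hence "Var x \<notin> (toric_kernel X A (avoids Z) :: ('v, 'k) mpoly set)"
    using x by (simp add: toric_kernel_def Var_def monomial_map_single)
  moreover have "Var x \<in> (toric_kernel X A (avoids Z') :: ('v, 'k) mpoly set)"
    using x assms(3)
    by (auto simp: toric_kernel_def Var_def monomial_map_single intro!: poly_ring_single_closed)
  ultimately show "(toric_kernel X A (avoids Z) :: ('v, 'k) mpoly set) \<noteq> toric_kernel X A (avoids Z')"
    by blast
qed

text \<open>\<open>chain_to N Z\<close> says that there is a chain of admissible sets with \<open>N\<close> strict inclusions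
  from \<open>{}\<close> to \<open>Z\<close>.\<close>

inductive chain_to :: "nat \<Rightarrow> 'v set \<Rightarrow> bool" where
  chain_empty: "chain_to 0 {}"
| chain_step: "chain_to N Z \<Longrightarrow> Z \<subset> Z' \<Longrightarrow> Z' \<subseteq> X \<Longrightarrow> admissible Z' \<Longrightarrow> chain_to (Suc N) Z'"

lemma chain_to_sets:
  assumes "chain_to N Z"
  shows "\<exists>f. f N = Z \<and> (\<forall>i\<le>N. f i \<subseteq> X \<and> admissible (f i)) \<and> (\<forall>i<N. f i \<subset> f (Suc i))"
  using assms
proof (induction rule: chain_to.induct)
  case chain_empty
  show ?case by (rule exI[of _ "\<lambda>_. {}"]) (simp add: admissible_def)
next
  case (chain_step N Z Z')
  then obtain f where f: "f N = Z" "\<forall>i\<le>N. f i \<subseteq> X \<and> admissible (f i)" "\<forall>i<N. f i \<subset> f (Suc i)"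
    by blast
  show ?case
    by (rule exI[of _ "f(Suc N := Z')"]) (use f chain_step.hyps in \<open>auto simp: le_Suc_eq less_Suc_eq\<close>)
qed

lemma admissible_extend:
  assumes "admissible Z" "B \<in> Bs" "S \<subseteq> Ev B \<union> Od B"
    and "(Z \<union> S) \<inter> Ev B \<noteq> {}" "(Z \<union> S) \<inter> Od B \<noteq> {}"
  shows "admissible (Z \<union> S)"
  unfolding admissible_def
proof
  fix C assume C: "C \<in> Bs"
  show "(Z \<union> S) \<inter> (Ev C \<union> Od C) = {} \<or> ((Z \<union> S) \<inter> Ev C \<noteq> {} \<and> (Z \<union> S) \<inter> Od C \<noteq> {})"
  proof (cases "C = B")
    case False
    have "S \<inter> (Ev C \<union> Od C) = {}"
      using assms(3) Ev_Od[OF C assms(2)] Ev_Od[OF assms(2) C] Ev_Ev[OF C assms(2) False]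
        Od_Od[OF C assms(2) False] by blast
    moreover have "Z \<inter> (Ev C \<union> Od C) = {} \<or> (Z \<inter> Ev C \<noteq> {} \<and> Z \<inter> Od C \<noteq> {})"
      using assms(1) C by (simp add: admissible_def)
    ultimately show ?thesis by blast
  qed (use assms in simp)
qed

lemma chain_to_admissible: "chain_to N Z \<Longrightarrow> admissible Z"
  by (induction rule: chain_to.induct) (simp_all add: admissible_def)

lemma chain_to_subset: "chain_to N Z \<Longrightarrow> Z \<subseteq> X"
  by (induction rule: chain_to.induct) simp_all

lemma chain_to_fill:
  assumes Z: "chain_to N Z" and B: "B \<in> Bs" and meets: "Z \<inter> Ev B \<noteq> {}" "Z \<inter> Od B \<noteq> {}"
    and S: "finite S" "S \<subseteq> Ev B \<union> Od B" "S \<inter> Z = {}"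
  shows "chain_to (N + card S) (Z \<union> S)"
  using S
proof (induction S rule: finite_induct)
  case (insert x S)
  have IH: "chain_to (N + card S) (Z \<union> S)" using insert by simp
  have "chain_to (Suc (N + card S)) (Z \<union> insert x S)"
  proof (rule chain_step[OF IH])
    show "Z \<union> S \<subset> Z \<union> insert x S" using insert by auto
    show "Z \<union> insert x S \<subseteq> X"
      using chain_to_subset[OF Z] insert.prems B by (auto simp: X_eq)
    show "admissible (Z \<union> insert x S)"
      by (rule admissible_extend[OF chain_to_admissible[OF Z] B insert.prems(1)]) (use meets in auto)
  qed
  thus ?case using insert.hyps by simp
qed (use Z in simp)

text \<open>An untouched block has to be entered with an even and an odd variable at once, which costs two
  variables for one step; its other \<open>2 e - 2\<close> variables can be added one by one. This gives
  \<open>2 e - 1\<close> steps for each block.\<close>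

lemma chain_to_blocks:
  assumes "C \<subseteq> Bs"
  shows "chain_to (card C * (2 * e - 1)) (\<Union>B\<in>C. Ev B \<union> Od B)"
  using finite_subset[OF assms finite_Bs] assms
proof (induction C rule: finite_induct)
  case empty
  show ?case using chain_empty by simp
next
  case (insert B C)
  have B: "B \<in> Bs" and C: "C \<subseteq> Bs" using insert.prems by auto
  let ?Z = "\<Union>B\<in>C. Ev B \<union> Od B"
  have IH: "chain_to (card C * (2 * e - 1)) ?Z" using insert.IH C by simp
  have disj: "?Z \<inter> (Ev B \<union> Od B) = {}"
  proof -
    have "(Ev D \<union> Od D) \<inter> (Ev B \<union> Od B) = {}" if "D \<in> C" for D
    proof -
      have D: "D \<in> Bs" "D \<noteq> B" using that C insert.hyps by auto
      show ?thesis
        using Ev_Od[OF D(1) B] Ev_Od[OF B D(1)] Ev_Ev[OF D(1) B D(2)] Od_Od[OF D(1) B D(2)] by blast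
    qed
    thus ?thesis by blast
  qed
  obtain x where x: "x \<in> Ev B" using card_Ev[OF B] e_pos by fastforce
  obtain y where y: "y \<in> Od B" using card_Od[OF B] e_pos by fastforce
  have "x \<noteq> y" using x y Ev_Od[OF B B] by blast
  have Z': "chain_to (Suc (card C * (2 * e - 1))) (?Z \<union> {x, y})"
  proof (rule chain_step[OF IH])
    show "?Z \<subset> ?Z \<union> {x, y}" using disj x by blast
    show "?Z \<union> {x, y} \<subseteq> X" using B C x y by (auto simp: X_eq)
    show "admissible (?Z \<union> {x, y})"
      by (rule admissible_extend[OF chain_to_admissible[OF IH] B]) (use x y in auto)
  qed
  let ?S = "(Ev B \<union> Od B) - {x, y}"
  have fill: "chain_to (Suc (card C * (2 * e - 1)) + card ?S) ((?Z \<union> {x, y}) \<union> ?S)"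
    by (rule chain_to_fill[OF Z' B]) (use x y disj finite_Ev finite_Od B in auto)
  have size: "card ?S = 2 * e - 2"
  proof -
    have "card (Ev B \<union> Od B) = 2 * e"
      using B by (subst card_Un_disjoint) (simp_all add: finite_Ev finite_Od Ev_Od card_Ev card_Od)
    thus ?thesis using x y \<open>x \<noteq> y\<close> by (subst card_Diff_subset) auto
  qed
  have union: "(?Z \<union> {x, y}) \<union> ?S = (\<Union>B\<in>insert B C. Ev B \<union> Od B)" using x y by blast
  have length: "Suc (card C * (2 * e - 1)) + (2 * e - 2) = card (insert B C) * (2 * e - 1)"
    using insert.hyps e_pos by simp
  show ?case using fill unfolding size union length .
qed

section \<open>Dimension and degree\<close>

abbreviation toric_ideal_of :: "('v, 'k::field) mpoly set" where
  "toric_ideal_of \<equiv> toric_kernel X A (\<lambda>_. True)"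

lemma krull_dim_toric:
  "krull_dim (poly_ring X Quot (toric_ideal_of :: ('v, 'k::field) mpoly set))
     = enat (card Bs * (2 * e - 1))"
proof -
  let ?D = "card Bs * (2 * e - 1)"
  interpret R: cring "poly_ring X :: ('v, 'k) mpoly ring" by (rule cring_poly_ring)
  have "chain_to ?D X" using chain_to_blocks[of Bs] by (simp add: X_eq)
  from chain_to_sets[OF this] obtain Z
    where "\<forall>i\<le>?D. Z i \<subseteq> X \<and> admissible (Z i)" "\<forall>i<?D. Z i \<subset> Z (Suc i)" by (elim exE conjE)
  hence Z: "\<And>i. i \<le> ?D \<Longrightarrow> Z i \<subseteq> X" "\<And>i. i \<le> ?D \<Longrightarrow> admissible (Z i)"
    "\<And>i. i < ?D \<Longrightarrow> Z i \<subset> Z (Suc i)" by simp_all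
  show ?thesis
  proof (rule R.krull_dim_quotient_eqI)
    show "ideal toric_ideal_of (poly_ring X :: ('v, 'k) mpoly ring)"
      by (rule ideal_toric_kernel) (simp_all add: A_add)
    show "primeideal (toric_kernel X A (avoids (Z i)) :: ('v, 'k) mpoly set) (poly_ring X)" for i
      by (rule primeideal_toric_kernel) (auto simp: A_add keys_plus_nat)
    show "toric_ideal_of \<subseteq> (toric_kernel X A (avoids (Z i)) :: ('v, 'k) mpoly set)" if "i \<le> ?D" for i
      using toric_kernel_mono[OF Z(2)[OF that], of "{}"] by simp
    show "(toric_kernel X A (avoids (Z i)) :: ('v, 'k) mpoly set) \<subset> toric_kernel X A (avoids (Z (Suc i)))"
      if "i < ?D" for i
      by (rule toric_kernel_strict_mono) (use Z that in auto)
    fix m and P :: "nat \<Rightarrow> ('v, 'k) mpoly set"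
    assume P: "\<And>i. i \<le> m \<Longrightarrow> primeideal (P i) (poly_ring X)" "\<And>i. i \<le> m \<Longrightarrow> toric_ideal_of \<subseteq> P i"
      "\<And>i. i < m \<Longrightarrow> P i \<subset> P (Suc i)"
    show "m \<le> ?D"
    proof (rule prime_chain_length_le[where A = A and Q = P and m = m, OF A_add A_zero P(1,3)])
      show "toric_ideal_of \<subseteq> P 0" by (rule P(2)) simp
      fix t
      have eq: "A ` {u. Poly_Mapping.keys u \<subseteq> X \<and> monom_deg u \<le> t}
          = A ` {u \<in> normal_forms Bs. monom_deg u \<le> t}"
        using image_A_normal_forms[of "\<lambda>d. d \<le> t"] by (simp add: monomials_def)
      have fin: "finite {u \<in> normal_forms Bs. monom_deg u \<le> t}"
        by (rule finite_subset[OF _ finite_monomials_degree_le[OF finite_X, of t]])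
          (auto simp: normal_forms_def)
      show "finite (A ` {u. Poly_Mapping.keys u \<subseteq> X \<and> monom_deg u \<le> t})"
        unfolding eq using fin by simp
      show "card (A ` {u. Poly_Mapping.keys u \<subseteq> X \<and> monom_deg u \<le> t}) \<le> e ^ card Bs * (t + 1) ^ ?D"
        unfolding eq using card_image_le[OF fin, of A] normal_forms_growth[of t] by (rule order_trans)
    qed
  qed
qed

lemma hilbert_series_toric:
  "hilbert_series X (toric_ideal_of :: ('v, 'k::field) mpoly set) = monomial_series (normal_forms Bs)"
proof (rule fps_ext)
  fix d
  have eq: "A ` {u. Poly_Mapping.keys u \<subseteq> X \<and> monom_deg u = d} = A ` {u \<in> normal_forms Bs. monom_deg u = d}"
    using image_A_normal_forms[of "\<lambda>d'. d' = d"] by (simp add: monomials_def)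
  have fin: "finite {u \<in> normal_forms Bs. monom_deg u = d}"
    by (rule finite_subset[OF _ finite_monomials_degree_le[OF finite_X, of d]])
      (auto simp: normal_forms_def)
  have "hilbert_fun X (toric_ideal_of :: ('v, 'k) mpoly set) d
      = card (A ` {u. Poly_Mapping.keys u \<subseteq> X \<and> monom_deg u = d})"
    by (rule hilbert_fun_toric_kernel[where A = A, OF A_add]) (use fin in \<open>simp add: eq\<close>)
  also have "\<dots> = card {u \<in> normal_forms Bs. monom_deg u = d}"
    unfolding eq by (rule card_image[OF inj_on_subset[OF normal_form_unique]]) auto
  finally show "fps_nth (hilbert_series X (toric_ideal_of :: ('v, 'k) mpoly set)) d
      = fps_nth (monomial_series (normal_forms Bs)) d"
    by (simp add: hilbert_series_def monomial_series_def)
qed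

text \<open>The series of normal forms is \<open>(1 - t^e)^b / (1 - t)^(2 e b)\<close> with \<open>b = card Bs\<close>; cancelling
  \<open>(1 - t)^b\<close> leaves the numerator \<open>(1 + t + ... + t^(e-1))^b\<close>, of value \<open>e^b\<close> at 1, over
  \<open>(1 - t)^((2 e - 1) b)\<close>.\<close>

theorem has_degree_toric:
  "has_degree X (toric_ideal_of :: ('v, 'k::field) mpoly set) (int e ^ card Bs)"
proof -
  let ?D = "card Bs * (2 * e - 1)" and ?H = "hilbert_series X (toric_ideal_of :: ('v, 'k) mpoly set)"
  define k :: "int poly" where "k = (\<Sum>i<e. Polynomial.monom 1 i) ^ card Bs"
  have k: "fps_of_poly k = (\<Sum>i<e. fps_X ^ i) ^ card Bs"
    by (simp add: k_def fps_of_poly_power fps_of_poly_sum fps_of_poly_monom')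
  have "card X = ?D + card Bs"
    using e_pos by (cases e) (simp_all add: card_X algebra_simps)
  hence "?H * (1 - fps_X) ^ ?D * (1 - fps_X) ^ card Bs = ?H * (1 - fps_X) ^ card X"
    by (simp add: power_add mult.assoc)
  also have "\<dots> = (1 - fps_X ^ e) ^ card Bs * (monomial_series (monomials X) * (1 - fps_X) ^ card X)"
    by (simp add: hilbert_series_toric normal_forms_series mult.assoc)
  also have "\<dots> = (1 - fps_X ^ e) ^ card Bs"
    by (simp add: monomial_series_all[OF finite_X])
  also have "\<dots> = fps_of_poly k * (1 - fps_X) ^ card Bs"
    by (simp add: one_diff_power_eq k power_mult_distrib mult.commute)
  finally have "?H * (1 - fps_X) ^ ?D * (1 - fps_X) ^ card Bs = fps_of_poly k * (1 - fps_X) ^ card Bs" .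
  moreover have "(1 - fps_X :: int fps) \<noteq> 0"
  proof
    assume "(1 - fps_X :: int fps) = 0"
    hence "fps_nth (1 - fps_X :: int fps) 0 = 0" by simp
    thus False by simp
  qed
  ultimately have series: "?H * (1 - fps_X) ^ ?D = fps_of_poly k" by simp
  have at_one: "poly k 1 = int e ^ card Bs" by (simp add: k_def poly_sum Polynomial.poly_monom)
  show ?thesis
    unfolding has_degree_def
  proof (intro exI conjI)
    show "krull_dim (poly_ring X Quot (toric_ideal_of :: ('v, 'k) mpoly set)) = enat ?D"
      by (rule krull_dim_toric)
    show "?H * (1 - fps_X) ^ ?D = fps_of_poly k" by (rule series)
    show "0 < poly k 1" using e_pos by (simp add: at_one)
    show "int e ^ card Bs = poly k 1" by (simp add: at_one)
  qed
qed

end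

section \<open>Hierarchical models\<close>

text \<open>The exponents of the parametrisation of a hierarchical model, with \<open>g H F\<close> in place of the
  index of \<open>\<theta>\<^bsub>(H,F)\<^esub>\<close>. The pairs themselves give the map that defines the toric ideal; codes in
  the natural numbers give a map with the same fibres into a linearly ordered monoid, where primality
  of kernels is available.\<close>

definition margins :: "('a set \<Rightarrow> 'a set \<Rightarrow> 'w) \<Rightarrow> 'a set set \<Rightarrow> ('a set \<Rightarrow>\<^sub>0 nat) \<Rightarrow> ('w \<Rightarrow>\<^sub>0 nat)" where
  "margins g \<F> u =
     (\<Sum>S\<in>Poly_Mapping.keys u. \<Sum>F\<in>\<F>. Poly_Mapping.single (g (S \<inter> F) F) (Poly_Mapping.lookup u S))"

lemma margins_superset:
  assumes "finite Y" "Poly_Mapping.keys u \<subseteq> Y"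
  shows "margins g \<F> u =
     (\<Sum>S\<in>Y. \<Sum>F\<in>\<F>. Poly_Mapping.single (g (S \<inter> F) F) (Poly_Mapping.lookup u S))"
  unfolding margins_def
  by (rule sum.mono_neutral_left) (use assms in \<open>auto simp: in_keys_iff\<close>)

lemma margins_add: "margins g \<F> (u + v) = margins g \<F> u + margins g \<F> v"
proof -
  let ?Y = "Poly_Mapping.keys u \<union> Poly_Mapping.keys v"
  have "finite ?Y" by simp
  note * = margins_superset[OF this, of _ g \<F>]
  show ?thesis
    by (subst (1 2 3) *) (auto simp: keys_plus_nat lookup_add single_add sum.distrib)
qed

text \<open>The exponent of \<open>\<theta>\<^bsub>(H,F)\<^esub>\<close> in the image of a monomial is the number of its variables,
  with multiplicity, whose index meets \<open>F\<close> in \<open>H\<close>.\<close>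

lemma lookup_margins:
  assumes fin: "finite X" "finite \<F>" and u: "Poly_Mapping.keys u \<subseteq> X"
    and inj: "inj_on (\<lambda>(H, F). g H F) {(H, F). H \<subseteq> F \<and> F \<in> \<F>}"
    and HF: "H \<subseteq> F" "F \<in> \<F>"
  shows "Poly_Mapping.lookup (margins g \<F> u) (g H F)
           = (\<Sum>S | S \<in> X \<and> S \<inter> F = H. Poly_Mapping.lookup u S)"
proof -
  have "Poly_Mapping.lookup (margins g \<F> u) (g H F)
      = (\<Sum>S\<in>X. \<Sum>G\<in>\<F>. if G = F then (if S \<inter> F = H then Poly_Mapping.lookup u S else 0) else 0)"
    unfolding margins_superset[OF fin(1) u] lookup_sum
  proof (intro sum.cong refl)
    fix S G assume G: "G \<in> \<F>"
    have "g (S \<inter> G) G = g H F \<longleftrightarrow> S \<inter> G = H \<and> G = F"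
      using inj_on_eq_iff[OF inj, of "(S \<inter> G, G)" "(H, F)"] G HF by auto
    thus "Poly_Mapping.lookup (Poly_Mapping.single (g (S \<inter> G) G) (Poly_Mapping.lookup u S)) (g H F)
        = (if G = F then (if S \<inter> F = H then Poly_Mapping.lookup u S else 0) else 0)"
      by (auto simp: lookup_single when_def)
  qed
  also have "\<dots> = (\<Sum>S\<in>X. if S \<inter> F = H then Poly_Mapping.lookup u S else 0)"
    using fin(2) HF(2) by simp
  also have "\<dots> = (\<Sum>S | S \<in> X \<and> S \<inter> F = H. Poly_Mapping.lookup u S)"
    by (rule sum.inter_filter[OF fin(1), symmetric])
  finally show ?thesis .
qed

lemma keys_margins:
  "Poly_Mapping.keys (margins g \<F> u) \<subseteq> {g H F | H F. H \<subseteq> F \<and> F \<in> \<F>}"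
proof
  fix w assume w: "w \<in> Poly_Mapping.keys (margins g \<F> u)"
  show "w \<in> {g H F | H F. H \<subseteq> F \<and> F \<in> \<F>}"
  proof (rule ccontr)
    assume "w \<notin> {g H F | H F. H \<subseteq> F \<and> F \<in> \<F>}"
    hence "g (S \<inter> F) F \<noteq> w" if "F \<in> \<F>" for S F using that by blast
    hence "Poly_Mapping.lookup (margins g \<F> u) w = 0"
      unfolding margins_def lookup_sum by (intro sum.neutral ballI) (simp add: lookup_single)
    thus False using w by (simp add: in_keys_iff)
  qed
qed

text \<open>For injective indexing the fibres do not depend on \<open>g\<close>.\<close>

lemma margins_eq_iff:
  assumes fin: "finite X" "finite \<F>" and uv: "Poly_Mapping.keys u \<subseteq> X" "Poly_Mapping.keys v \<subseteq> X"
    and inj: "inj_on (\<lambda>(H, F). g H F) {(H, F). H \<subseteq> F \<and> F \<in> \<F>}"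
  shows "margins g \<F> u = margins g \<F> v \<longleftrightarrow>
    (\<forall>F\<in>\<F>. \<forall>H. H \<subseteq> F \<longrightarrow> (\<Sum>S | S \<in> X \<and> S \<inter> F = H. Poly_Mapping.lookup u S)
      = (\<Sum>S | S \<in> X \<and> S \<inter> F = H. Poly_Mapping.lookup v S))"
    (is "_ \<longleftrightarrow> ?R")
proof
  assume eq: "margins g \<F> u = margins g \<F> v"
  show ?R
  proof (intro ballI allI impI)
    fix F H assume HF: "F \<in> \<F>" "H \<subseteq> F"
    show "(\<Sum>S | S \<in> X \<and> S \<inter> F = H. Poly_Mapping.lookup u S)
        = (\<Sum>S | S \<in> X \<and> S \<inter> F = H. Poly_Mapping.lookup v S)"
      unfolding lookup_margins[OF fin uv(1) inj HF(2,1), symmetric]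
        lookup_margins[OF fin uv(2) inj HF(2,1), symmetric] eq ..
  qed
next
  assume R: ?R
  show "margins g \<F> u = margins g \<F> v"
  proof (rule poly_mapping_eqI)
    fix w
    show "Poly_Mapping.lookup (margins g \<F> u) w = Poly_Mapping.lookup (margins g \<F> v) w"
    proof (cases "w \<in> {g H F | H F. H \<subseteq> F \<and> F \<in> \<F>}")
      case True
      then obtain H F where HF: "w = g H F" "H \<subseteq> F" "F \<in> \<F>" by blast
      show ?thesis
        unfolding HF(1) lookup_margins[OF fin uv(1) inj HF(2,3)] lookup_margins[OF fin uv(2) inj HF(2,3)]
        using R HF(2,3) by blast
    next
      case False
      have "w \<notin> Poly_Mapping.keys (margins g \<F> u)" "w \<notin> Poly_Mapping.keys (margins g \<F> v)"
        by (rule contra_subsetD[OF keys_margins False])+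
      thus ?thesis by (simp add: in_keys_iff)
    qed
  qed
qed

lemma prod_single_one:
  "(\<Prod>i\<in>I. Poly_Mapping.single (a i) (1::'k::field)) = Poly_Mapping.single (\<Sum>i\<in>I. a i) 1"
  by (induction I rule: infinite_finite_induct) (auto simp: mult_single)

lemma Var_power: "(Var x :: ('v, 'k::field) mpoly) ^ c = Poly_Mapping.single (Poly_Mapping.single x c) 1"
  by (induction c) (auto simp: Var_def mult_single simp flip: single_add)

lemma hier_map_eq_monomial_map: "hier_map \<Delta> = monomial_map (margins Pair (facets \<Delta>)) (\<lambda>_. True)"
proof
  fix q :: "(nat set, 'k::field) mpoly"
  show "hier_map \<Delta> q = monomial_map (margins Pair (facets \<Delta>)) (\<lambda>_. True) q"
    unfolding hier_map_def subst_hom_def monomial_map_def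
    by (intro sum.cong refl)
      (simp add: prod_power_distrib Var_power prod_single_one Const_def mult_single margins_def)
qed

lemma toric_ideal_eq_toric_kernel:
  "toric_ideal n \<Delta> = toric_kernel (Pow {1..n}) (margins Pair (facets \<Delta>)) (\<lambda>_. True)"
  by (simp add: toric_ideal_def toric_kernel_def a_kernel_def' hier_map_eq_monomial_map)

section \<open>Facets that miss one vertex each\<close>

text \<open>Adding or removing the vertex 1 swaps the even and the odd subsets, which together are in
  bijection with the subsets of \<open>{1..k}\<close>.\<close>

lemma card_block_parity:
  fixes n k :: nat
  assumes k: "1 \<le> k" "k \<le> n" and B: "B \<subseteq> {k+1..n}"
  shows "card {S \<in> Pow {1..n}. S \<inter> {k+1..n} = B \<and> even (card (S \<inter> {1..k}))} = 2 ^ (k - 1)"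
      (is "card ?E = _")
    and "card {S \<in> Pow {1..n}. S \<inter> {k+1..n} = B \<and> odd (card (S \<inter> {1..k}))} = 2 ^ (k - 1)"
      (is "card ?O = _")
proof -
  have fin: "finite ?E" "finite ?O" by (rule finite_subset[of _ "Pow {1..n}"]; auto)+
  have one: "1 \<in> {1..k}" "1 \<notin> {k+1..n}" using k by auto
  define flip where "flip = (\<lambda>S :: nat set. if 1 \<in> S then S - {1} else insert 1 S)"
  have flip: "flip (flip S) = S" "flip S \<in> Pow {1..n} \<longleftrightarrow> S \<in> Pow {1..n}"
    "flip S \<inter> {k+1..n} = S \<inter> {k+1..n}" for S
    using one k by (auto simp: flip_def)
  have flip_parity: "even (card (flip S \<inter> {1..k})) \<longleftrightarrow> odd (card (S \<inter> {1..k}))" for S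
  proof (cases "1 \<in> S")
    case True
    hence "S \<inter> {1..k} = insert 1 (flip S \<inter> {1..k})" "1 \<notin> flip S \<inter> {1..k}"
      using one by (auto simp: flip_def)
    hence "card (S \<inter> {1..k}) = Suc (card (flip S \<inter> {1..k}))"
      by (metis card_insert_disjoint finite_Int finite_atLeastAtMost)
    thus ?thesis by simp
  next
    case False
    hence "flip S \<inter> {1..k} = insert 1 (S \<inter> {1..k})" "1 \<notin> S \<inter> {1..k}"
      using one by (auto simp: flip_def)
    hence "card (flip S \<inter> {1..k}) = Suc (card (S \<inter> {1..k}))"
      by (metis card_insert_disjoint finite_Int finite_atLeastAtMost)
    thus ?thesis by simp
  qed
  have "bij_betw flip ?E ?O"
  proof (rule bij_betw_byWitness[where f' = flip])
    show "flip ` ?E \<subseteq> ?O" "flip ` ?O \<subseteq> ?E"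
      by (intro image_subsetI; simp only: mem_Collect_eq flip flip_parity simp_thms)+
  qed (simp_all add: flip(1))
  hence eq: "card ?E = card ?O" by (rule bij_betw_same_card)
  have "card ?E + card ?O = card (?E \<union> ?O)"
    by (rule card_Un_disjoint[symmetric]) (use fin in auto)
  also have "card (?E \<union> ?O) = 2 ^ k"
  proof -
    have "bij_betw (\<lambda>A. A \<union> B) (Pow {1..k}) (?E \<union> ?O)"
    proof (rule bij_betw_byWitness[where f' = "\<lambda>S. S \<inter> {1..k}"])
      have disjoint: "{1..k} \<inter> {k+1..n} = {}" by auto
      show "\<forall>A\<in>Pow {1..k}. (A \<union> B) \<inter> {1..k} = A" using B disjoint by blast
      show "\<forall>S\<in>?E \<union> ?O. S \<inter> {1..k} \<union> B = S"
      proof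
        fix S assume "S \<in> ?E \<union> ?O"
        hence "S \<subseteq> {1..n}" "S \<inter> {k+1..n} = B" by auto
        moreover have "{1..n} = {1..k} \<union> {k+1..n}" using k by auto
        ultimately show "S \<inter> {1..k} \<union> B = S" by blast
      qed
      show "(\<lambda>A. A \<union> B) ` Pow {1..k} \<subseteq> ?E \<union> ?O"
      proof (rule image_subsetI)
        fix A assume "A \<in> Pow {1..k}"
        hence "A \<union> B \<in> Pow {1..n}" "(A \<union> B) \<inter> {k+1..n} = B" using B k by auto
        thus "A \<union> B \<in> ?E \<union> ?O" by blast
      qed
    qed blast
    hence "card (?E \<union> ?O) = card (Pow {1..k})" by (rule bij_betw_same_card[symmetric])
    thus ?thesis by (simp add: card_Pow)
  qed
  also have "(2::nat) ^ k = 2 * 2 ^ (k - 1)" using k by (cases k) simp_all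
  finally show "card ?E = 2 ^ (k - 1)" "card ?O = 2 ^ (k - 1)" using eq by simp_all
qed

text \<open>The margin at \<open>H\<close> of the facet that misses \<open>i\<close> is the sum of the exponents at \<open>H\<close> and at
  \<open>H \<union> {i}\<close>. So equal margins mean that the difference of the exponents changes its sign whenever
  an element of \<open>{1..k}\<close> is added, while elements of \<open>{k+1..n}\<close> cannot be changed at all: the
  difference is \<open>c\<close> on the even and \<open>-c\<close> on the odd sets with a given intersection with
  \<open>{k+1..n}\<close>.\<close>

lemma margins_eq_iff_alternating:
  fixes n k :: nat
  assumes k: "k \<le> n" and \<F>: "\<F> = {{1..n} - {i} | i. i \<in> {1..k}}"
    and uv: "Poly_Mapping.keys u \<subseteq> Pow {1..n}" "Poly_Mapping.keys v \<subseteq> Pow {1..n}"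
    and inj: "inj_on (\<lambda>(H, F). g H F) {(H, F). H \<subseteq> F \<and> F \<in> \<F>}"
  shows "margins g \<F> u = margins g \<F> v \<longleftrightarrow> (\<forall>B\<in>Pow {k+1..n}. \<exists>c::int.
    (\<forall>S\<in>{S \<in> Pow {1..n}. S \<inter> {k+1..n} = B \<and> even (card (S \<inter> {1..k}))}.
       int (Poly_Mapping.lookup u S) = int (Poly_Mapping.lookup v S) + c) \<and>
    (\<forall>S\<in>{S \<in> Pow {1..n}. S \<inter> {k+1..n} = B \<and> odd (card (S \<inter> {1..k}))}.
       int (Poly_Mapping.lookup u S) = int (Poly_Mapping.lookup v S) - c))"
    (is "_ \<longleftrightarrow> ?R")
proof -
  let ?l = Poly_Mapping.lookup
  have pair: "(\<Sum>S | S \<in> Pow {1..n} \<and> S \<inter> ({1..n} - {i}) = H. f S) = f H + f (insert i H)"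
    if "i \<in> {1..k}" "H \<subseteq> {1..n} - {i}" for i H and f :: "nat set \<Rightarrow> nat"
  proof -
    have "{S. S \<in> Pow {1..n} \<and> S \<inter> ({1..n} - {i}) = H} = {H, insert i H}"
      using that k by auto
    moreover have "H \<noteq> insert i H" using that by auto
    ultimately show ?thesis by simp
  qed
  have "margins g \<F> u = margins g \<F> v \<longleftrightarrow>
    (\<forall>F\<in>\<F>. \<forall>H. H \<subseteq> F \<longrightarrow> (\<Sum>S | S \<in> Pow {1..n} \<and> S \<inter> F = H. ?l u S)
      = (\<Sum>S | S \<in> Pow {1..n} \<and> S \<inter> F = H. ?l v S))"
    by (rule margins_eq_iff[OF _ _ uv inj]) (simp_all add: \<F>)
  also have "\<dots> \<longleftrightarrow> (\<forall>i\<in>{1..k}. \<forall>H. H \<subseteq> {1..n} - {i} \<longrightarrow>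
      ?l u H + ?l u (insert i H) = ?l v H + ?l v (insert i H))" (is "_ \<longleftrightarrow> ?M")
  proof -
    have "\<forall>H. H \<subseteq> {1..n} - {i} \<longrightarrow> (\<Sum>S | S \<in> Pow {1..n} \<and> S \<inter> ({1..n} - {i}) = H. ?l u S)
        = ?l u H + ?l u (insert i H)" if "i \<in> {1..k}" for i
      using pair[OF that] by simp
    moreover have "\<forall>H. H \<subseteq> {1..n} - {i} \<longrightarrow> (\<Sum>S | S \<in> Pow {1..n} \<and> S \<inter> ({1..n} - {i}) = H. ?l v S)
        = ?l v H + ?l v (insert i H)" if "i \<in> {1..k}" for i
      using pair[OF that] by simp
    moreover have "(\<forall>F\<in>\<F>. P F) \<longleftrightarrow> (\<forall>i\<in>{1..k}. P ({1..n} - {i}))" for P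
      unfolding \<F> by blast
    ultimately show ?thesis by simp
  qed
  also have "?M \<longleftrightarrow> ?R"
  proof
    assume M: ?M
    show ?R
    proof
      fix B assume B: "B \<in> Pow {k+1..n}"
      define c where "c = int (?l u B) - int (?l v B)"
      have alt: "int (?l u (D \<union> B)) = int (?l v (D \<union> B)) + (if even (card D) then c else - c)"
        if "D \<subseteq> {1..k}" for D
        using finite_subset[OF that finite_atLeastAtMost] that
      proof (induction D rule: finite_induct)
        case (insert i D)
        have "i \<in> {1..k}" "D \<union> B \<subseteq> {1..n} - {i}" using insert.hyps insert.prems B k by auto
        hence "?l u (D \<union> B) + ?l u (insert i (D \<union> B)) = ?l v (D \<union> B) + ?l v (insert i (D \<union> B))"
          using M by blast
        thus ?case using insert by auto
      qed (simp_all add: c_def)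
      have split: "S = (S \<inter> {1..k}) \<union> B" if "S \<in> Pow {1..n}" "S \<inter> {k+1..n} = B" for S
        using that by auto
      show "\<exists>c::int.
        (\<forall>S\<in>{S \<in> Pow {1..n}. S \<inter> {k+1..n} = B \<and> even (card (S \<inter> {1..k}))}.
          int (?l u S) = int (?l v S) + c) \<and>
        (\<forall>S\<in>{S \<in> Pow {1..n}. S \<inter> {k+1..n} = B \<and> odd (card (S \<inter> {1..k}))}.
          int (?l u S) = int (?l v S) - c)"
      proof (intro exI conjI ballI)
        fix S assume "S \<in> {S \<in> Pow {1..n}. S \<inter> {k+1..n} = B \<and> even (card (S \<inter> {1..k}))}"
        thus "int (?l u S) = int (?l v S) + c"
          using alt[of "S \<inter> {1..k}"] split[of S] by simp
      next
        fix S assume "S \<in> {S \<in> Pow {1..n}. S \<inter> {k+1..n} = B \<and> odd (card (S \<inter> {1..k}))}"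
        thus "int (?l u S) = int (?l v S) - c"
          using alt[of "S \<inter> {1..k}"] split[of S] by simp
      qed
    qed
  next
    assume R: ?R
    show ?M
    proof (intro ballI allI impI)
      fix i H assume i: "i \<in> {1..k}" and H: "H \<subseteq> {1..n} - {i}"
      obtain c :: int where
        c: "\<And>S. S \<subseteq> {1..n} \<Longrightarrow> S \<inter> {k+1..n} = H \<inter> {k+1..n} \<Longrightarrow> even (card (S \<inter> {1..k})) \<Longrightarrow>
              int (?l u S) = int (?l v S) + c"
          "\<And>S. S \<subseteq> {1..n} \<Longrightarrow> S \<inter> {k+1..n} = H \<inter> {k+1..n} \<Longrightarrow> odd (card (S \<inter> {1..k})) \<Longrightarrow>
              int (?l u S) = int (?l v S) - c"
        using R[rule_format, of "H \<inter> {k+1..n}"] by auto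
      have S: "H \<subseteq> {1..n}" "insert i H \<subseteq> {1..n}" "insert i H \<inter> {k+1..n} = H \<inter> {k+1..n}"
        using i H k by auto
      have "insert i H \<inter> {1..k} = insert i (H \<inter> {1..k})" "i \<notin> H \<inter> {1..k}" using i H by auto
      hence "card (insert i H \<inter> {1..k}) = Suc (card (H \<inter> {1..k}))"
        by (metis card_insert_disjoint finite_Int finite_atLeastAtMost)
      hence "int (?l u H) + int (?l u (insert i H)) = int (?l v H) + int (?l v (insert i H))"
        using c(1)[of H] c(2)[of H] c(1)[of "insert i H"] c(2)[of "insert i H"] S
        by (cases "even (card (H \<inter> {1..k}))") auto
      thus "?l u H + ?l u (insert i H) = ?l v H + ?l v (insert i H)" by linarith
    qed
  qed
  finally show ?thesis .
qed

theorem corollary7p5: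
  fixes n k :: nat and T :: "nat set set"
  assumes "1 \<le> k" and "k \<le> n"
    and "simplicial_complex {1..n} T"
    and "facets T = {{1..n} - {i} | i. i \<in> {1..k}}"
  shows "has_degree (Pow {1..n}) (toric_ideal n T :: (nat set, 'k::field) mpoly set)
           (2 ^ ((k - 1) * 2 ^ (n - k)))"
proof -
  let ?X = "Pow {1..n}"
  \<comment> \<open>Pairs of finite sets of naturals are linearly ordered through this code.\<close>
  define code :: "nat set \<Rightarrow> nat set \<Rightarrow> nat" where
    "code = (\<lambda>H F. prod_encode (set_encode H, set_encode F))"
  define Ev Od where
    "Ev = (\<lambda>B. {S \<in> ?X. S \<inter> {k+1..n} = B \<and> even (card (S \<inter> {1..k}))})" and
    "Od = (\<lambda>B. {S \<in> ?X. S \<inter> {k+1..n} = B \<and> odd (card (S \<inter> {1..k}))})"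
  have inj_code: "inj_on (\<lambda>(H, F). code H F) {(H, F). H \<subseteq> F \<and> F \<in> facets T}"
  proof (rule inj_onI, clarify)
    fix H F H' F'
    assume *: "H \<subseteq> F" "F \<in> facets T" "H' \<subseteq> F'" "F' \<in> facets T" "code H F = code H' F'"
    hence "finite F" "finite F'" by (auto simp: assms(4))
    hence "finite F" "finite F'" "finite H" "finite H'" using * by (auto intro: finite_subset)
    thus "H = H' \<and> F = F'"
      using * by (simp add: code_def prod_encode_eq set_encode_eq)
  qed
  have inj_Pair: "inj_on (\<lambda>(H, F). Pair H F) {(H, F). H \<subseteq> F \<and> F \<in> facets T}"
    by (simp add: inj_on_def)
  have fibres: "margins code (facets T) u = margins code (facets T) v \<longleftrightarrow>
      (\<forall>B\<in>Pow {k+1..n}. \<exists>c::int.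
        (\<forall>S\<in>Ev B. int (Poly_Mapping.lookup u S) = int (Poly_Mapping.lookup v S) + c) \<and>
        (\<forall>S\<in>Od B. int (Poly_Mapping.lookup u S) = int (Poly_Mapping.lookup v S) - c))"
    if "u \<in> monomials ?X" "v \<in> monomials ?X" for u v
    unfolding Ev_def Od_def
    by (rule margins_eq_iff_alternating[OF assms(2,4) _ _ inj_code])
      (use that in \<open>simp_all add: monomials_def\<close>)
  interpret binomial_blocks ?X "Pow {k+1..n}" Ev Od "2 ^ (k - 1)" "margins code (facets T)"
  proof
    show "?X = (\<Union>B\<in>Pow {k+1..n}. Ev B \<union> Od B)"
    proof (intro equalityI subsetI)
      fix S assume "S \<in> ?X"
      hence "S \<in> Ev (S \<inter> {k+1..n}) \<union> Od (S \<inter> {k+1..n})" by (simp add: Ev_def Od_def)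
      thus "S \<in> (\<Union>B\<in>Pow {k+1..n}. Ev B \<union> Od B)" by blast
    next
      fix S assume "S \<in> (\<Union>B\<in>Pow {k+1..n}. Ev B \<union> Od B)"
      thus "S \<in> ?X" unfolding Ev_def Od_def by blast
    qed
    show "finite (Pow {k+1..n})" "1 \<le> (2::nat) ^ (k - 1)" by simp_all
    fix B C assume B: "B \<in> Pow {k+1..n}"
    show "card (Ev B) = 2 ^ (k - 1)" "card (Od B) = 2 ^ (k - 1)"
      using card_block_parity[OF assms(1,2)] B unfolding Ev_def Od_def by blast+
    show "finite (Ev B)" "finite (Od B)"
      unfolding Ev_def Od_def by simp_all
    show "Ev B \<inter> Od C = {}" "B \<noteq> C \<Longrightarrow> Ev B \<inter> Ev C = {}" "B \<noteq> C \<Longrightarrow> Od B \<inter> Od C = {}"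
      unfolding Ev_def Od_def by blast+
  qed (rule margins_add fibres | assumption)+
  have "monomial_map (margins Pair (facets T)) (\<lambda>_. True) q = 0 \<longleftrightarrow>
      monomial_map (margins code (facets T)) (\<lambda>_. True) q = 0"
    if q: "q \<in> carrier (poly_ring ?X)" for q :: "(nat set, 'k) mpoly"
  proof -
    have "margins Pair (facets T) u = margins Pair (facets T) v \<longleftrightarrow>
        margins code (facets T) u = margins code (facets T) v"
      if "u \<in> Poly_Mapping.keys q" "v \<in> Poly_Mapping.keys q" for u v
    proof -
      have uv: "Poly_Mapping.keys u \<subseteq> ?X" "Poly_Mapping.keys v \<subseteq> ?X"
        using q that by (auto simp: poly_ring_carrier)
      have "finite (facets T)" by (simp add: assms(4))
      thus ?thesis
        by (simp only: margins_eq_iff[OF finite_X _ uv inj_Pair] margins_eq_iff[OF finite_X _ uv inj_code])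
    qed
    thus ?thesis by (intro iffI; elim monomial_map_eq_0_transfer; simp)
  qed
  hence "toric_ideal n T = (toric_ideal_of :: (nat set, 'k) mpoly set)"
    by (auto simp: toric_ideal_eq_toric_kernel toric_kernel_def)
  moreover have "(2::int) ^ ((k - 1) * 2 ^ (n - k)) = int (2 ^ (k - 1)) ^ card (Pow {k+1..n})"
    by (simp add: card_Pow power_mult)
  ultimately show ?thesis using has_degree_toric by metis
qed

end
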